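(* Let $q$ be a real locally integrable function on $\mathbb{R}$ such that $\mathbb{L}_q=-\partial_x^2+q$ is semibounded below and such that for a.e. real $k$ the right Jost solution $\psi(x,k)$ ($\psi\sim e^{\mathrm{i}kx}$, $\psi'\sim\mathrm{i}ke^{\mathrm{i}kx}$, $x\to+\infty$) exists. Let $D$ be the set of embedded bound states (positive eigenvalues) of $\mathbb{L}_q$ and let $D_0=\{\omega_n^2:1\le n\le N\}\subset D$, $N<\infty$, $\omega_n>0$, be such that each $\omega_n^2$ is a simple eigenvalue and the functions $R(k)$ and $(k-\omega_n)\psi(x,k)$ are continuous in real $k$ at $\omega_n$. Let $\{\phi_n:1\le n\le N\}$ be an orthonormal set in $L^2(\mathbb{R})$ of real eigenfunctions, $\phi_n$ corresponding to $\omega_n^2$. Let $\mathbf{G}_-(x)$ be the $N\times N$ matrix with entries $\int_{-\infty}^x\phi_n(s)\phi_m(s)\,\mathrm{d}s$. Then the set of embedded eigenvalues of the potential $$q_{-N}(x)=q(x)-2\partial_x^2\log\det(\mathbf{I}-\mathbf{G}_-(x))$$ coincides with $D\setminus D_0$.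
   Context: The right reflection coefficient is $R(k)=-W(\varphi(x,k),\overline{\psi(x,k)})/W(\varphi(x,k),\psi(x,k))$ for a.e. real $k$, where $\varphi(x,k)$ is the boundary value on the real axis of the left Weyl solution (the solution of $\mathbb{L}_qu=k^2u$ in $L^2(a,-\infty)$ for $\operatorname{Im}k>0$) and $W(f,g)=fg'-f'g$. *)

theory Defs
  imports "HOL-Analysis.Analysis"
begin

text \<open>Solutions of  -u'' + q u = lam u  (Caratheodory sense): u is differentiable with
  derivative u', and u' is the indefinite integral of (q - lam) u.\<close>
definition sl_sol :: "(real \<Rightarrow> real) \<Rightarrow> complex \<Rightarrow> (real \<Rightarrow> complex) \<Rightarrow> (real \<Rightarrow> complex) \<Rightarrow> bool" where
  "sl_sol q lam u u' \<longleftrightarrow>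
     (\<forall>x. (u has_vector_derivative u' x) (at x)) \<and>
     (\<forall>x y. x \<le> y \<longrightarrow>
        ((\<lambda>s. (complex_of_real (q s) - lam) * u s) has_integral (u' y - u' x)) {x..y})"

definition locally_integrable :: "(real \<Rightarrow> real) \<Rightarrow> bool" where
  "locally_integrable q \<longleftrightarrow> (\<forall>a b. set_integrable lborel {a..b} q)"

definition semibounded_below :: "(real \<Rightarrow> real) \<Rightarrow> bool" where
  "semibounded_below q \<longleftrightarrow> (\<exists>C::real. \<forall>f f'::real \<Rightarrow> real.
      (\<forall>x. (f has_real_derivative f' x) (at x)) \<and> continuous_on UNIV f' \<and>
      (\<exists>r. \<forall>x. \<bar>x\<bar> > r \<longrightarrow> f x = 0) \<longrightarrow>
      (\<integral>x. (f' x)\<^sup>2 + q x * (f x)\<^sup>2 \<partial>lborel) \<ge> C * (\<integral>x. (f x)\<^sup>2 \<partial>lborel))"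

definition square_integrable :: "(real \<Rightarrow> complex) \<Rightarrow> bool" where
  "square_integrable u \<longleftrightarrow> integrable lborel (\<lambda>x. (cmod (u x))\<^sup>2)"

definition is_eigenvalue :: "(real \<Rightarrow> real) \<Rightarrow> real \<Rightarrow> bool" where
  "is_eigenvalue q lam \<longleftrightarrow> (\<exists>u u'. sl_sol q (complex_of_real lam) u u' \<and>
       u \<noteq> (\<lambda>_. 0) \<and> square_integrable u)"

definition embedded_eigenvalues :: "(real \<Rightarrow> real) \<Rightarrow> real set" where
  "embedded_eigenvalues q = {lam. lam > 0 \<and> is_eigenvalue q lam}"

definition simple_eigenvalue :: "(real \<Rightarrow> real) \<Rightarrow> real \<Rightarrow> bool" where
  "simple_eigenvalue q lam \<longleftrightarrow> (\<exists>u0 u0'. sl_sol q (complex_of_real lam) u0 u0' \<and>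
       u0 \<noteq> (\<lambda>_. 0) \<and> square_integrable u0 \<and>
       (\<forall>v v'. sl_sol q (complex_of_real lam) v v' \<and> square_integrable v \<longrightarrow>
           (\<exists>c. v = (\<lambda>x. c * u0 x))))"

definition is_jost :: "(real \<Rightarrow> real) \<Rightarrow> real \<Rightarrow> (real \<Rightarrow> complex) \<Rightarrow> (real \<Rightarrow> complex) \<Rightarrow> bool" where
  "is_jost q k psi psi' \<longleftrightarrow> sl_sol q (complex_of_real (k\<^sup>2)) psi psi' \<and>
     ((\<lambda>x. psi x - exp (\<i> * complex_of_real (k * x))) \<longlongrightarrow> 0) at_top \<and>
     ((\<lambda>x. psi' x - \<i> * complex_of_real k * exp (\<i> * complex_of_real (k * x))) \<longlongrightarrow> 0) at_top"

definition jost_exists :: "(real \<Rightarrow> real) \<Rightarrow> real \<Rightarrow> bool" where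
  "jost_exists q k \<longleftrightarrow> (\<exists>psi psi'. is_jost q k psi psi')"

definition jost :: "(real \<Rightarrow> real) \<Rightarrow> real \<Rightarrow> (real \<Rightarrow> complex) \<times> (real \<Rightarrow> complex)" where
  "jost q k = (SOME p. is_jost q k (fst p) (snd p))"

text \<open>Left Weyl solution for Im z > 0 (solution of L_q u = z^2 u, square integrable on (-infinity,0]),
  normalised by u(0) = 1; weyl_m is its value u'(0) (the Weyl m-function).\<close>
definition weyl_m :: "(real \<Rightarrow> real) \<Rightarrow> complex \<Rightarrow> complex" where
  "weyl_m q z = (SOME m. \<exists>u u'. sl_sol q (z\<^sup>2) u u' \<and> u 0 = 1 \<and> u' 0 = m \<and>
       set_integrable lborel {..0} (\<lambda>x. (cmod (u x))\<^sup>2))"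

text \<open>Boundary value on the real axis: limit of z = k + i eps as eps -> 0+.  The boundary value
  phi(x,k) of the normalised left Weyl solution is the solution with phi(0,k)=1, phi'(0,k)=m.\<close>
definition weyl_bv :: "(real \<Rightarrow> real) \<Rightarrow> real \<Rightarrow> complex \<Rightarrow> bool" where
  "weyl_bv q k m \<longleftrightarrow> ((\<lambda>eps. weyl_m q (Complex k eps)) \<longlongrightarrow> m) (at_right 0)"

definition wr :: "complex \<Rightarrow> complex \<Rightarrow> complex \<Rightarrow> complex \<Rightarrow> complex" where
  "wr f f' g g' = f * g' - f' * g"

text \<open>Right reflection coefficient R(k) = - W(phi, conj psi) / W(phi, psi) (Wronskians at x = 0),
  defined (Some) where all ingredients exist and W(phi,psi) is nonzero.\<close>
definition reflection :: "(real \<Rightarrow> real) \<Rightarrow> real \<Rightarrow> complex option" where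
  "reflection q k =
    (if jost_exists q k \<and> (\<exists>m. weyl_bv q k m) then
       (let psi = fst (jost q k); psi' = snd (jost q k); m = (THE m. weyl_bv q k m);
            den = wr 1 m (psi 0) (psi' 0)
        in if den \<noteq> 0 then Some (- wr 1 m (cnj (psi 0)) (cnj (psi' 0)) / den) else None)
     else None)"

definition reflection_continuous_at :: "(real \<Rightarrow> real) \<Rightarrow> real \<Rightarrow> bool" where
  "reflection_continuous_at q w \<longleftrightarrow> (\<exists>r0. \<forall>e>0. \<exists>d>0. \<forall>k r.
       \<bar>k - w\<bar> < d \<longrightarrow> reflection q k = Some r \<longrightarrow> cmod (r - r0) < e)"

definition jost_pole_continuous_at :: "(real \<Rightarrow> real) \<Rightarrow> real \<Rightarrow> bool" where
  "jost_pole_continuous_at q w \<longleftrightarrow> (\<forall>x. \<exists>c. \<forall>e>0. \<exists>d>0. \<forall>k.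
       \<bar>k - w\<bar> < d \<longrightarrow> jost_exists q k \<longrightarrow>
       cmod (complex_of_real (k - w) * fst (jost q k) x - c) < e)"

definition Gminus :: "('n::finite \<Rightarrow> real \<Rightarrow> real) \<Rightarrow> real \<Rightarrow> real^'n^'n" where
  "Gminus phi x = (\<chi> i j. (LINT s:{..x}|lborel. phi i s * phi j s))"

end

theory Submission
  imports Defs
begin

text \<open>Put \<open>G(x) = I - G\<^sub>-(x) = \<integral>\<^sub>x\<^sup>\<infinity> \<phi> \<phi>\<^sup>T\<close>, \<open>A = G\<^sup>-\<^sup>1\<close> and \<open>\<Phi> = A \<phi>\<close>. Then \<open>(ln det G)' = - \<phi> \<bullet> \<Phi>\<close>, and
  the double commutation \<open>u \<mapsto> v = u - \<Phi> \<bullet> \<integral>\<^sub>x\<^sup>\<infinity> \<phi> u\<close> carries solutions over \<open>q\<close> to solutions over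
  the new potential; its inverse is the same construction for the data \<open>(\<Phi>, - A, - G)\<close>. Square
  integrability is preserved because \<open>v\<^sup>2 - u\<^sup>2\<close> is the derivative of \<open>c \<bullet> A c\<close>, \<open>c = \<integral>\<^sub>x\<^sup>\<infinity> \<phi> u\<close>, which
  is bounded by Bessel's inequality. The integrals are Wronskians, since semiboundedness forces
  Wronskians of square integrable solutions to vanish at both ends. A square integrable solution
  over the new potential at some \<open>\<omega>\<^sub>n\<^sup>2\<close> would be a nontrivial combination of the components of
  \<open>\<Phi>\<close>, but no such combination is square integrable at \<open>+\<infinity>\<close>, where \<open>G\<close> tends to \<open>0\<close>.\<close>

section \<open>Indefinite integrals of locally integrable functions\<close>

text \<open>The shape of the proof comes from an asymmetry: semiboundedness, and with it every
  statement about Wronskians at infinity, is at hand for \<open>q\<close> only. On the way from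
  \<open>q\<close> to the new potential the vector \<open>c\<close> is a convergent integral, and
  orthogonality of eigenfunctions fixes its constants. On the way back \<open>\<Phi>\<close> is not
  square integrable at +infinity, so \<open>c\<close> is merely some antiderivative. Constants that
  no shift of \<open>c\<close> can remove, those at indices with \<open>\<Lambda> n = lam\<close>,
  survive as an inhomogeneous term; this is why a general right-hand side is carried through the
  Sturm-Liouville part. The term can be eliminated only after the transformed function is known to
  be square integrable, by an argument over \<open>q\<close>. A second obstacle is regularity: with
  \<open>q\<close> only locally integrable, derivatives of solutions are only absolutely continuous,
  so identities for second derivatives appear in integrated form. Finally, pairwise distinctness of
  the \<open>w n\<close> is derived from orthonormality and simplicity; it enters the invertibility
  of \<open>G\<close>.\<close>

text \<open>Encodes local absolute continuity of \<open>F\<close> with density \<open>f\<close>,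
  without derivatives almost everywhere. Absolute integrability is demanded because it survives
  multiplication by continuous functions, which gauge integrability alone does not.\<close>

definition indef :: "(real \<Rightarrow> real) \<Rightarrow> (real \<Rightarrow> real) \<Rightarrow> bool" where
  "indef f F \<longleftrightarrow> (\<forall>a b. a \<le> b \<longrightarrow>
     f absolutely_integrable_on {a..b} \<and> (f has_integral F b - F a) {a..b})"

lemma indefI:
  assumes "\<And>a b. a \<le> b \<Longrightarrow> f absolutely_integrable_on {a..b}"
    and "\<And>a b. a \<le> b \<Longrightarrow> (f has_integral F b - F a) {a..b}"
  shows "indef f F"
  using assms by (auto simp: indef_def)

lemma indef_abs: "indef f F \<Longrightarrow> a \<le> b \<Longrightarrow> f absolutely_integrable_on {a..b}"
  and indef_int: "indef f F \<Longrightarrow> a \<le> b \<Longrightarrow> (f has_integral F b - F a) {a..b}"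
  by (auto simp: indef_def)

lemma indef_cong: "indef f F \<Longrightarrow> (\<And>x. f x = g x) \<Longrightarrow> (\<And>x. F x = H x) \<Longrightarrow> indef g H"
  by (metis ext)

lemma indef_add:
  assumes "indef f F" "indef g H" shows "indef (\<lambda>x. f x + g x) (\<lambda>x. F x + H x)"
proof (rule indefI)
  fix a b :: real assume ab: "a \<le> b"
  show "(\<lambda>x. f x + g x) absolutely_integrable_on {a..b}"
    using indef_abs[OF assms(1) ab] indef_abs[OF assms(2) ab] by (rule set_integral_add(1))
  show "((\<lambda>x. f x + g x) has_integral F b + H b - (F a + H a)) {a..b}"
    using has_integral_add[OF indef_int[OF assms(1) ab] indef_int[OF assms(2) ab]]
    by (simp add: algebra_simps)
qed

lemma indef_cmult:
  assumes "indef f F" shows "indef (\<lambda>x. c * f x) (\<lambda>x. c * F x)"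
proof (rule indefI)
  fix a b :: real assume ab: "a \<le> b"
  show "(\<lambda>x. c * f x) absolutely_integrable_on {a..b}"
    using indef_abs[OF assms(1) ab] by (auto intro: set_integrable_mult_right)
  show "((\<lambda>x. c * f x) has_integral c * F b - c * F a) {a..b}"
    using has_integral_mult_right[OF indef_int[OF assms(1) ab], of c]
    by (simp add: algebra_simps)
qed

lemma indef_diff:
  assumes "indef f F" "indef g H" shows "indef (\<lambda>x. f x - g x) (\<lambda>x. F x - H x)"
  using indef_add[OF assms(1) indef_cmult[OF assms(2), of "-1"]] by simp

lemma indef_const: "indef (\<lambda>x. 0) (\<lambda>x. c)"
  by (auto simp: indef_def)

lemma indef_sum:
  assumes "\<And>i. i \<in> I \<Longrightarrow> indef (f i) (F i)"
  shows "indef (\<lambda>x. \<Sum>i\<in>I. f i x) (\<lambda>x. \<Sum>i\<in>I. F i x)"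
  using assms by (induction I rule: infinite_finite_induct) (auto intro: indef_add indef_const)

lemma indef_C1:
  assumes "\<And>x. (g has_real_derivative g' x) (at x)" "continuous_on UNIV g'"
  shows "indef g' g"
proof (rule indefI)
  fix a b :: real assume ab: "a \<le> b"
  show "g' absolutely_integrable_on {a..b}"
    using assms(2) by (intro absolutely_integrable_continuous_real) (rule continuous_on_subset, auto)
  show "(g' has_integral g b - g a) {a..b}"
    by (rule fundamental_theorem_of_calculus[OF ab])
       (metis assms(1) has_field_derivative_at_within has_real_derivative_iff_has_vector_derivative)
qed

lemma indef_continuous:
  assumes "indef f F" shows "continuous_on UNIV F"
proof -
  have "continuous (at x) F" for x
  proof -
    have i: "f integrable_on {x-1..x+1}"
      using indef_int[OF assms, of "x-1" "x+1"] by (auto simp: integrable_on_def)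
    have "continuous_on {x-1..x+1} (\<lambda>y. F (x-1) + integral {x-1..y} f)"
      by (intro continuous_intros indefinite_integral_continuous_1 i)
    then have "continuous_on {x-1..x+1} F"
    proof (rule continuous_on_eq)
      fix y assume "y \<in> {x-1..x+1}"
      then have "x - 1 \<le> y" by simp
      from integral_unique[OF indef_int[OF assms this]]
      show "F (x-1) + integral {x-1..y} f = F y" by simp
    qed
    then show ?thesis
      by (rule continuous_on_interior) simp
  qed
  then show ?thesis by (simp add: continuous_at_imp_continuous_on)
qed

lemma indef_deriv:
  assumes "indef f F" "continuous_on UNIV f"
  shows "(F has_real_derivative f x) (at x)"
proof -
  have "((\<lambda>y. integral {x-1..y} f) has_vector_derivative f x) (at x within {x-1..x+1})"
    by (rule integral_has_vector_derivative) (use assms(2) in \<open>auto intro: continuous_on_subset\<close>)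
  then have "((\<lambda>y. integral {x-1..y} f) has_real_derivative f x) (at x within {x-1..x+1})"
    by (simp add: has_real_derivative_iff_has_vector_derivative)
  then have "((\<lambda>y. integral {x-1..y} f) has_real_derivative f x) (at x)"
    by (simp add: at_within_Icc_at)
  then have "((\<lambda>y. F (x-1) + integral {x-1..y} f) has_real_derivative f x) (at x)"
    by (auto intro!: derivative_eq_intros)
  then show ?thesis
  proof (rule has_field_derivative_transform_within[of _ _ _ _ 1])
    fix y assume "dist y x < 1"
    then have "x - 1 \<le> y" by (auto simp: dist_real_def)
    from integral_unique[OF indef_int[OF assms(1) this]]
    show "F (x-1) + integral {x-1..y} f = F y" by simp
  qed simp_all
qed

lemma absolutely_integrable_mult_continuous:
  fixes f g :: "real \<Rightarrow> real"
  assumes "f absolutely_integrable_on {a..b}" "continuous_on {a..b} g"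
  shows "(\<lambda>x. f x * g x) absolutely_integrable_on {a..b}"
proof -
  have "(\<lambda>x. g x * f x) absolutely_integrable_on {a..b}"
  proof (rule absolutely_integrable_bounded_measurable_product_real)
    show "g \<in> borel_measurable (lebesgue_on {a..b})"
      by (rule continuous_imp_measurable_on_sets_lebesgue[OF assms(2)]) auto
    show "bounded (g ` {a..b})"
      using assms(2) compact_continuous_image compact_imp_bounded by blast
  qed (use assms in auto)
  then show ?thesis by (simp add: mult.commute)
qed

text \<open>The derivative of \<open>F g - \<integral> (f g + F g')\<close> vanishes everywhere, although \<open>F\<close> is
  differentiable almost everywhere only: its increments over \<open>{x..y}\<close> are bounded by a multiple of
  \<open>(y - x) \<integral> \<bar>f\<bar>\<close>.\<close>

lemma indef_mult:
  assumes F: "indef f F"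
    and g: "\<And>x. (g has_real_derivative g' x) (at x)" "continuous_on UNIV g'"
  shows "indef (\<lambda>x. f x * g x + F x * g' x) (\<lambda>x. F x * g x)"
proof (rule indefI)
  fix a b :: real assume ab: "a \<le> b"
  note gi = indef_C1[OF g]
  have cg: "continuous_on S g" for S
    using g(1) DERIV_continuous_on has_field_derivative_at_within by blast
  have cg': "continuous_on S g'" for S using g(2) continuous_on_subset by blast
  have cF: "continuous_on S F" for S using indef_continuous[OF F] continuous_on_subset by blast
  let ?h = "\<lambda>x. f x * g x + F x * g' x"
  have abs: "?h absolutely_integrable_on {x..y}" if "x \<le> y" for x y
    by (intro set_integral_add absolutely_integrable_mult_continuous indef_abs[OF F that] cg
        absolutely_integrable_continuous_real continuous_intros cF cg')
  show "?h absolutely_integrable_on {a..b}" by (rule abs[OF ab])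
  have hint: "?h integrable_on {x..y}" if "x \<le> y" for x y
    using abs[OF that] set_lebesgue_integral_eq_integral(1) by blast
  have nint: "(\<lambda>s. \<bar>f s\<bar>) integrable_on {x..y}" if "x \<le> y" for x y
    using indef_abs[OF F that] absolutely_integrable_on_def by (metis (no_types, lifting) ext real_norm_def)
  obtain M where M: "\<And>s. s \<in> {a..b} \<Longrightarrow> \<bar>g' s\<bar> \<le> M"
    using compact_imp_bounded[OF compact_continuous_image[OF cg' compact_Icc, of a b]]
    unfolding bounded_real by blast
  have M0: "M \<ge> 0" using M[of a] ab by auto
  define N where "N t = integral {a..t} (\<lambda>s. \<bar>f s\<bar>)" for t
  define H where "H t = F t * g t - integral {a..t} ?h" for t
  have key: "\<bar>H y - H x\<bar> \<le> 2 * M * (y - x) * (N y - N x)" if xy: "a \<le> x" "x \<le> y" "y \<le> b" for x y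
  proof -
    have Nxy: "integral {x..y} (\<lambda>s. \<bar>f s\<bar>) = N y - N x"
      using Henstock_Kurzweil_Integration.integral_combine[OF xy(1,2) nint] xy by (simp add: N_def)
    have hxy: "integral {x..y} ?h = integral {a..y} ?h - integral {a..x} ?h"
      using Henstock_Kurzweil_Integration.integral_combine[OF xy(1,2) hint] xy by simp
    \<comment> \<open>The increment of \<open>F * g\<close> is written exactly, with
      \<open>g\<close> frozen at the right end and \<open>F\<close> at the left end. Subtracting the
      integral of \<open>?h\<close> leaves two products of small oscillations.\<close>
    have "((\<lambda>s. f s * g y + F x * g' s - ?h s) has_integral
        ((F y - F x) * g y + F x * (g y - g x) - (integral {a..y} ?h - integral {a..x} ?h))) {x..y}"
      by (intro has_integral_diff has_integral_add has_integral_mult_left has_integral_mult_right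
          indef_int[OF F xy(2)] indef_int[OF gi xy(2)])
         (use hint[OF xy(2)] hxy in \<open>simp add: has_integral_integral\<close>)
    then have HI: "((\<lambda>s. f s * (g y - g s) + (F x - F s) * g' s) has_integral (H y - H x)) {x..y}"
      by (rule has_integral_eq_rhs[OF has_integral_eq, rotated]) (auto simp: H_def algebra_simps)
    have BI: "((\<lambda>s. (M * (y - x)) * \<bar>f s\<bar> + (N y - N x) * M) has_integral
       ((M * (y - x)) * (N y - N x) + (y - x) * ((N y - N x) * M))) {x..y}"
      using nint[OF xy(2)] Nxy xy
      by (intro has_integral_add has_integral_mult_right has_integral_const_real[THEN has_integral_eq_rhs])
         (auto simp: has_integral_integral)
    have "norm (H y - H x) \<le> (M * (y - x)) * (N y - N x) + (y - x) * ((N y - N x) * M)"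
    proof -
      have "norm (f s * (g y - g s) + (F x - F s) * g' s) \<le> (M * (y - x)) * \<bar>f s\<bar> + (N y - N x) * M"
        if s: "s \<in> {x..y}" for s
      proof -
        have "\<bar>g y - g s\<bar> \<le> M * (y - s)"
        proof -
          have "norm (integral {s..y} g') \<le> integral {s..y} (\<lambda>_. M)"
            using s xy by (intro integral_norm_bound_integral integrable_continuous_real cg') (auto intro!: M)
          then show ?thesis using indef_int[OF gi, of s y] s by (simp add: integral_unique mult.commute)
        qed
        also have "\<dots> \<le> M * (y - x)" using s M0 by (intro mult_left_mono) auto
        finally have 1: "\<bar>g y - g s\<bar> \<le> M * (y - x)" .
        have "norm (integral {x..s} f) \<le> integral {x..s} (\<lambda>s. \<bar>f s\<bar>)"
          using s by (intro integral_norm_bound_integral nint has_integral_integrable[OF indef_int[OF F]]) auto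
        also have "\<dots> \<le> integral {x..y} (\<lambda>s. \<bar>f s\<bar>)"
          using s by (intro integral_subset_le nint) auto
        finally have 2: "\<bar>F x - F s\<bar> \<le> N y - N x"
          using indef_int[OF F, of x s] s Nxy by (simp add: integral_unique abs_minus_commute)
        have 3: "\<bar>g' s\<bar> \<le> M" using M s xy by auto
        have "\<bar>f s * (g y - g s) + (F x - F s) * g' s\<bar> \<le> \<bar>f s\<bar> * \<bar>g y - g s\<bar> + \<bar>F x - F s\<bar> * \<bar>g' s\<bar>"
          by (metis abs_mult abs_triangle_ineq)
        also have "\<dots> \<le> \<bar>f s\<bar> * (M * (y - x)) + (N y - N x) * M"
          using 1 2 3 by (intro add_mono mult_mono) auto
        finally show ?thesis by (simp add: mult.commute)
      qed
      from integral_norm_bound_integral[OF has_integral_integrable[OF HI] has_integral_integrable[OF BI] this]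
      show ?thesis using HI BI by (simp add: integral_unique)
    qed
    then show ?thesis by (simp add: algebra_simps)
  qed
  have "(H has_real_derivative 0) (at x within {a..b})" if x: "x \<in> {a..b}" for x
  proof -
    have "continuous_on {a..b} N"
      unfolding N_def by (rule indefinite_integral_continuous_1[OF nint[OF ab]])
    then have "(N \<longlongrightarrow> N x) (at x within {a..b})"
      using x by (simp add: continuous_on_def)
    then have "((\<lambda>y. 2 * M * \<bar>N y - N x\<bar>) \<longlongrightarrow> 2 * M * \<bar>N x - N x\<bar>) (at x within {a..b})"
      by (intro tendsto_intros)
    then have lim: "((\<lambda>y. 2 * M * \<bar>N y - N x\<bar>) \<longlongrightarrow> 0) (at x within {a..b})"
      by simp
    have "((\<lambda>y. (H y - H x) / (y - x)) \<longlongrightarrow> 0) (at x within {a..b})"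
    proof (rule Lim_null_comparison[OF _ lim])
      show "\<forall>\<^sub>F y in at x within {a..b}. norm ((H y - H x) / (y - x)) \<le> 2 * M * \<bar>N y - N x\<bar>"
        unfolding eventually_at
      proof (intro exI[of _ 1] conjI ballI impI)
        fix y assume y: "y \<in> {a..b}" "y \<noteq> x \<and> dist y x < 1"
        have "\<bar>H y - H x\<bar> \<le> 2 * M * \<bar>y - x\<bar> * \<bar>N y - N x\<bar>"
        proof (cases "x \<le> y")
          case True
          have "\<bar>H y - H x\<bar> \<le> 2 * M * (y - x) * (N y - N x)" using key[of x y] True x y by auto
          also have "\<dots> \<le> 2 * M * (y - x) * \<bar>N y - N x\<bar>" using M0 True by (intro mult_left_mono) auto
          finally show ?thesis using True by simp
        next
          case False
          have "\<bar>H x - H y\<bar> \<le> 2 * M * (x - y) * (N x - N y)" using key[of y x] False x y by auto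
          also have "\<dots> \<le> 2 * M * (x - y) * \<bar>N x - N y\<bar>" using M0 False by (intro mult_left_mono) auto
          finally show ?thesis using False by (simp add: abs_minus_commute)
        qed
        then show "norm ((H y - H x) / (y - x)) \<le> 2 * M * \<bar>N y - N x\<bar>"
          using y by (simp add: pos_divide_le_eq mult_ac)
      qed simp
    qed
    then show ?thesis by (simp add: has_field_derivative_iff)
  qed
  then obtain c where "\<forall>x\<in>{a..b}. H x = c"
    using has_field_derivative_zero_constant[of "{a..b}" H] by auto
  then have "H b = H a" using ab by simp
  then have "integral {a..b} ?h = F b * g b - F a * g a" by (simp add: H_def)
  then show "(?h has_integral F b * g b - F a * g a) {a..b}"
    using hint[OF ab] by (metis has_integral_integral)
qed

section \<open>Inhomogeneous Sturm-Liouville equations\<close>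

text \<open>The equation -u'' + q u = F in integrated form. For eigenfunctions \<open>F\<close> is
  \<open>lam * u\<close>; the inverse transformation at first yields an additional term in
  \<open>F\<close>.\<close>

definition sturm :: "(real \<Rightarrow> real) \<Rightarrow> (real \<Rightarrow> real) \<Rightarrow> (real \<Rightarrow> real) \<Rightarrow> (real \<Rightarrow> real) \<Rightarrow> bool" where
  "sturm q F u u' \<longleftrightarrow> (\<forall>x. (u has_real_derivative u' x) (at x)) \<and> indef (\<lambda>x. q x * u x - F x) u'"

lemma sturm_deriv: "sturm q F u u' \<Longrightarrow> (u has_real_derivative u' x) (at x)"
  and sturm_indef: "sturm q F u u' \<Longrightarrow> indef (\<lambda>x. q x * u x - F x) u'"
  by (auto simp: sturm_def)

lemma sturm_continuous:
  assumes "sturm q F u u'"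
  shows "continuous_on S u" "continuous_on S u'"
proof -
  show "continuous_on S u"
    using sturm_deriv[OF assms] DERIV_continuous_on has_field_derivative_at_within by blast
  show "continuous_on S u'"
    using indef_continuous[OF sturm_indef[OF assms]] continuous_on_subset by blast
qed

text \<open>Lagrange's identity: the terms with \<open>q\<close> and the products of first
  derivatives cancel between the two product rules.\<close>

lemma sturm_wronskian:
  assumes f: "sturm q F f f'" and g: "sturm q H g g'"
  shows "indef (\<lambda>x. F x * g x - f x * H x) (\<lambda>x. f x * g' x - f' x * g x)"
proof -
  have "indef (\<lambda>x. (q x * g x - H x) * f x + g' x * f' x) (\<lambda>x. g' x * f x)"
    by (rule indef_mult[OF sturm_indef[OF g] sturm_deriv[OF f] sturm_continuous(2)[OF f]])
  moreover have "indef (\<lambda>x. (q x * f x - F x) * g x + f' x * g' x) (\<lambda>x. f' x * g x)"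
    by (rule indef_mult[OF sturm_indef[OF f] sturm_deriv[OF g] sturm_continuous(2)[OF g]])
  ultimately show ?thesis
    by (rule indef_cong[OF indef_diff]) (auto simp: algebra_simps)
qed

lemma sturm_combination:
  assumes "sturm q F f f'" "sturm q H g g'"
  shows "sturm q (\<lambda>x. a * F x + b * H x) (\<lambda>x. a * f x + b * g x) (\<lambda>x. a * f' x + b * g' x)"
  unfolding sturm_def
proof
  show "\<forall>x. ((\<lambda>x. a * f x + b * g x) has_real_derivative a * f' x + b * g' x) (at x)"
    using sturm_deriv[OF assms(1)] sturm_deriv[OF assms(2)] by (auto intro!: derivative_eq_intros)
  show "indef (\<lambda>x. q x * (a * f x + b * g x) - (a * F x + b * H x)) (\<lambda>x. a * f' x + b * g' x)"
    using indef_add[OF indef_cmult[OF sturm_indef[OF assms(1)], of a] indef_cmult[OF sturm_indef[OF assms(2)], of b]]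
    by (rule indef_cong) (auto simp: algebra_simps)
qed

section \<open>Borel and gauge integrals of products and of compactly supported functions\<close>

lemma set_integrable_lborel_mult_continuous:
  fixes q g :: "real \<Rightarrow> real"
  assumes "set_integrable lborel {a..b} q" "continuous_on UNIV g"
  shows "set_integrable lborel {a..b} (\<lambda>x. q x * g x)"
proof -
  obtain M where M: "\<And>x. x \<in> {a..b} \<Longrightarrow> \<bar>g x\<bar> \<le> M"
    using compact_imp_bounded[OF compact_continuous_image[OF continuous_on_subset[OF assms(2)] compact_Icc, of a b]]
    unfolding bounded_real by blast
  have gm: "g \<in> borel_measurable lborel"
    using borel_measurable_continuous_onI[OF assms(2)] by simp
  have qi: "integrable lborel (\<lambda>x. indicator {a..b} x * q x)"
    using assms(1) by (simp add: set_integrable_def)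
  have "integrable lborel (\<lambda>x. (indicator {a..b} x * q x) * g x)"
  proof (rule Bochner_Integration.integrable_bound)
    show "integrable lborel (\<lambda>x. M * (indicator {a..b} x * q x))"
      using qi by simp
    show "(\<lambda>x. (indicator {a..b} x * q x) * g x) \<in> borel_measurable lborel"
      by (rule borel_measurable_times[OF borel_measurable_integrable[OF qi] gm])
    show "AE x in lborel. norm (indicator {a..b} x * q x * g x) \<le> norm (M * (indicator {a..b} x * q x))"
    proof (intro AE_I2)
      fix x
      show "norm (indicator {a..b} x * q x * g x) \<le> norm (M * (indicator {a..b} x * q x))"
        using M[of x] by (cases "x \<in> {a..b}") (auto simp: abs_mult mult.commute intro!: mult_right_mono)
    qed
  qed
  then show ?thesis by (simp add: set_integrable_def mult.assoc)
qed

lemma set_integrable_lborel_continuous: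
  fixes g :: "real \<Rightarrow> real"
  assumes "continuous_on UNIV g"
  shows "set_integrable lborel {a..b} g"
  using borel_integrable_atLeastAtMost'[of a b g] assms continuous_on_subset by blast

lemma set_integrable_lborel_absolutely_integrable:
  fixes g :: "real \<Rightarrow> real"
  assumes "set_integrable lborel S g"
  shows "g absolutely_integrable_on S"
  using assms integrable_completion[of "\<lambda>x. indicator S x *\<^sub>R g x" lborel]
  by (auto simp: set_integrable_def dest: borel_measurable_integrable)

lemma locally_integrable_mult_continuous:
  assumes "locally_integrable q" "continuous_on UNIV g"
  shows "(\<lambda>x. q x * g x) absolutely_integrable_on {a..b}"
  using assms by (auto simp: locally_integrable_def
      intro!: set_integrable_lborel_absolutely_integrable set_integrable_lborel_mult_continuous)

lemma lborel_integral_supported: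
  fixes g :: "real \<Rightarrow> real"
  assumes "set_integrable lborel {a..b} g" "\<And>x. x \<notin> {a..b} \<Longrightarrow> g x = 0"
  shows "(LINT x|lborel. g x) = integral {a..b} g"
proof -
  have "(LINT x|lborel. g x) = (LINT x:{a..b}|lborel. g x)"
    unfolding set_lebesgue_integral_def
    by (rule Bochner_Integration.integral_cong) (use assms(2) in \<open>auto simp: indicator_def\<close>)
  then show ?thesis using set_borel_integral_eq_integral(2)[OF assms(1)] by simp
qed

section \<open>A bump function and the Wronskian bound\<close>

lemma has_real_derivative_max_power:
  "((\<lambda>r::real. max 0 r ^ Suc (Suc n)) has_real_derivative real (Suc (Suc n)) * max 0 r ^ Suc n) (at r)"
proof -
  consider "r < 0" | "r = 0" | "r > 0" by linarith
  then show ?thesis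
  proof cases
    case 1
    have "((\<lambda>r::real. 0) has_real_derivative 0) (at r)" by simp
    then show ?thesis
      by (rule has_field_derivative_transform_within_open[of _ _ _ "{..<0}", THEN DERIV_cong]) (use 1 in auto)
  next
    case 2
    have "((\<lambda>y::real. max 0 y ^ Suc (Suc n) / y) \<longlongrightarrow> 0) (at 0)"
    proof (rule Lim_null_comparison)
      show "\<forall>\<^sub>F y in at 0. norm (max 0 y ^ Suc (Suc n) / y) \<le> max 0 y ^ Suc n"
        by (rule always_eventually) (auto simp: max_def)
      show "((\<lambda>y::real. max 0 y ^ Suc n) \<longlongrightarrow> 0) (at 0)"
        by (auto intro!: tendsto_eq_intros)
    qed
    then show ?thesis using 2 by (simp add: has_field_derivative_iff)
  next
    case 3
    have "((\<lambda>r::real. r ^ Suc (Suc n)) has_real_derivative real (Suc (Suc n)) * r ^ Suc n) (at r)"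
      using DERIV_pow[of "Suc (Suc n)" r UNIV] by simp
    then show ?thesis
      by (rule has_field_derivative_transform_within_open[of _ _ _ "{0<..}", THEN DERIV_cong]) (use 3 in auto)
  qed
qed

text \<open>The bump is the positive part of x(1 - x) to the power 3, the least integer power with a
  continuous second derivative. The square of its first derivative later serves as the weight of an
  average, hence the need for positive mass.\<close>

lemma exists_C2_bump:
  obtains b b1 b2 :: "real \<Rightarrow> real" and B :: real
  where "\<And>x. (b has_real_derivative b1 x) (at x)" "\<And>x. (b1 has_real_derivative b2 x) (at x)"
    "continuous_on UNIV b2"
    "\<And>x. x \<notin> {0<..<1} \<Longrightarrow> b x = 0 \<and> b1 x = 0"
    "\<And>x. \<bar>b x\<bar> \<le> B" "\<And>x. \<bar>b1 x\<bar> \<le> B" "\<And>x. \<bar>b2 x\<bar> \<le> B"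
    "integral {0..1} (\<lambda>x. (b1 x)\<^sup>2) > 0"
proof -
  define r :: "real \<Rightarrow> real" where "r = (\<lambda>x. x * (1 - x))"
  define b where "b = (\<lambda>x. max 0 (r x) ^ 3)"
  define b1 where "b1 = (\<lambda>x. 3 * max 0 (r x) ^ 2 * (1 - 2 * x))"
  define b2 where "b2 = (\<lambda>x. 3 * (2 * max 0 (r x) * (1 - 2 * x)) * (1 - 2 * x) + 3 * max 0 (r x) ^ 2 * (- 2))"
  have dr: "(r has_real_derivative 1 - 2 * x) (at x)" for x
    unfolding r_def by (auto intro!: derivative_eq_intros)
  have d3: "((\<lambda>x. max 0 (r x) ^ 3) has_real_derivative 3 * max 0 (r x) ^ 2 * (1 - 2 * x)) (at x)" for x
    using DERIV_chain2[OF has_real_derivative_max_power[of 1] dr, of x] by (simp add: eval_nat_numeral)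
  have d2: "((\<lambda>x. max 0 (r x) ^ 2) has_real_derivative 2 * max 0 (r x) * (1 - 2 * x)) (at x)" for x
    using DERIV_chain2[OF has_real_derivative_max_power[of 0] dr, of x] by (simp add: eval_nat_numeral)
  have D0: "(b has_real_derivative b1 x) (at x)" for x unfolding b_def b1_def by (rule d3)
  have D1: "(b1 has_real_derivative b2 x) (at x)" for x
    unfolding b1_def b2_def by (rule derivative_eq_intros d2 refl | simp)+
  have C2: "continuous_on S b2" for S
    unfolding b2_def r_def by (intro continuous_intros)
  have C0: "continuous_on S b" for S
    using D0 DERIV_continuous_on has_field_derivative_at_within by blast
  have C1: "continuous_on S b1" for S
    using D1 DERIV_continuous_on has_field_derivative_at_within by blast
  have r0: "max 0 (r x) = 0" if "x \<notin> {0<..<1}" for x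
    using that unfolding r_def by (auto simp: max_def mult_le_0_iff zero_le_mult_iff not_less) 
  have Z: "b x = 0 \<and> b1 x = 0 \<and> b2 x = 0" if "x \<notin> {0<..<1}" for x
    using r0[OF that] by (simp add: b_def b1_def b2_def)
  have bdd: "\<exists>B. \<forall>x\<in>{0..1}. \<bar>h x\<bar> \<le> B" if "continuous_on {0..1} h" for h :: "real \<Rightarrow> real"
    using compact_imp_bounded[OF compact_continuous_image[OF that compact_Icc]]
    unfolding bounded_real by blast
  obtain B0 B1 B2 where B: "\<forall>x\<in>{0..1}. \<bar>b x\<bar> \<le> B0" "\<forall>x\<in>{0..1}. \<bar>b1 x\<bar> \<le> B1" "\<forall>x\<in>{0..1}. \<bar>b2 x\<bar> \<le> B2"
    using bdd[OF C0] bdd[OF C1] bdd[OF C2] by metis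
  define B where "B = max 0 (max B0 (max B1 B2))"
  have bnd: "\<bar>b x\<bar> \<le> B \<and> \<bar>b1 x\<bar> \<le> B \<and> \<bar>b2 x\<bar> \<le> B" for x
  proof (cases "x \<in> {0<..<1}")
    case True
    then have "x \<in> {0..1}" by auto
    then show ?thesis using B unfolding B_def by (meson le_max_iff_disj)
  next
    case False
    then show ?thesis using Z by (auto simp: B_def)
  qed
  have "integral {0..1} (\<lambda>x. (b1 x)\<^sup>2) \<noteq> 0"
  proof
    assume "integral {0..1} (\<lambda>x. (b1 x)\<^sup>2) = 0"
    then have "((\<lambda>x. (b1 x)\<^sup>2) has_integral 0) (cbox 0 1)"
      using integrable_continuous_real[of 0 1 "\<lambda>x. (b1 x)\<^sup>2"] C1
      by (auto simp: has_integral_integrable_integral intro!: continuous_intros)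
    \<comment> \<open>On the unit interval \<open>b1\<close> vanishes only at 0, 1/2 and 1, so 1/4
      is a point where it does not.\<close>
    then have "(b1 (1/4))\<^sup>2 = 0"
      by (rule has_integral_0_cbox_imp_0[rotated 2]) (auto intro!: continuous_intros C1)
    then show False by (simp add: b1_def r_def)
  qed
  moreover have "integral {0..1} (\<lambda>x. (b1 x)\<^sup>2) \<ge> 0"
    by (intro integral_nonneg integrable_continuous_real continuous_intros C1) auto
  ultimately have K: "integral {0..1} (\<lambda>x. (b1 x)\<^sup>2) > 0" by linarith
  show thesis
    by (rule that[of b b1 b2 B]) (use D0 D1 C2 Z bnd K in auto)
qed

text \<open>Test the form with \<open>b\<^sub>1 f + t b g\<close>, \<open>t = \<plusminus>1\<close>, where \<open>b\<^sub>1 = b'\<close> and \<open>b\<close> is a bump on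
  \<open>{R..R+1}\<close>: up to a total derivative the cross term is \<open>- 2 t b\<^sub>1\<^sup>2 W(f, g)\<close>, and all the other
  terms are controlled by \<open>f\<^sup>2 + F\<^sup>2 + g\<^sup>2 + H\<^sup>2\<close>. This is a quantitative form of the fact that
  semiboundedness implies the limit point case.\<close>

lemma semibounded_wronskian_bound:
  assumes q: "locally_integrable q" and sb: "semibounded_below q"
  obtains M where "\<And>f f' F g g' H R. \<lbrakk>sturm q F f f'; sturm q H g g';
      continuous_on UNIV F; continuous_on UNIV H\<rbrakk> \<Longrightarrow>
    \<bar>f R * g' R - f' R * g R\<bar> \<le>
      M * integral {R..R+1} (\<lambda>x. (f x)\<^sup>2 + (F x)\<^sup>2 + (g x)\<^sup>2 + (H x)\<^sup>2)"
proof -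
  obtain C where C: "\<And>h h' :: real \<Rightarrow> real. (\<And>x. (h has_real_derivative h' x) (at x)) \<Longrightarrow>
     continuous_on UNIV h' \<Longrightarrow> (\<exists>r. \<forall>x. \<bar>x\<bar> > r \<longrightarrow> h x = 0) \<Longrightarrow>
     (\<integral>x. (h' x)\<^sup>2 + q x * (h x)\<^sup>2 \<partial>lborel) \<ge> C * (\<integral>x. (h x)\<^sup>2 \<partial>lborel)"
    using sb unfolding semibounded_below_def by blast
  obtain b b1 b2 :: "real \<Rightarrow> real" and B :: real
    where db: "\<And>x. (b has_real_derivative b1 x) (at x)" and db1: "\<And>x. (b1 has_real_derivative b2 x) (at x)"
      and cb2: "continuous_on UNIV b2"
      and supp: "\<And>x. x \<notin> {0<..<1} \<Longrightarrow> b x = 0 \<and> b1 x = 0"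
      and B: "\<And>x. \<bar>b x\<bar> \<le> B" "\<And>x. \<bar>b1 x\<bar> \<le> B" "\<And>x. \<bar>b2 x\<bar> \<le> B"
      and Kpos: "integral {0..1} (\<lambda>x. (b1 x)\<^sup>2) > 0"
    using exists_C2_bump by blast
  define K where "K = integral {0..1} (\<lambda>x. (b1 x)\<^sup>2)"
  have K0: "K > 0" using Kpos by (simp add: K_def)
  show thesis
  \<comment> \<open>The summand 1 pays for the variation of the Wronskian over
    \<open>{R..R+1}\<close>; the quotient bounds its average with weight \<beta>1 squared, whose
    total mass is \<open>K\<close>.\<close>
  proof (rule that[of "1 + (3 + \<bar>C\<bar>) * B\<^sup>2 / K"])
    fix f f' F g g' H R
    assume f: "sturm q F f f'" and g: "sturm q H g g'"
      and cF: "continuous_on UNIV F" and cH: "continuous_on UNIV H"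
    define S where "S = (\<lambda>x. (f x)\<^sup>2 + (F x)\<^sup>2 + (g x)\<^sup>2 + (H x)\<^sup>2)"
    define W where "W = (\<lambda>x. f x * g' x - f' x * g x)"
    define \<beta> \<beta>1 \<beta>2 where "\<beta> = (\<lambda>x. b (x - R))" and "\<beta>1 = (\<lambda>x. b1 (x - R))" and "\<beta>2 = (\<lambda>x. b2 (x - R))"
    have d\<beta>: "(\<beta> has_real_derivative \<beta>1 x) (at x)" for x
      unfolding \<beta>_def \<beta>1_def by (rule DERIV_chain2[OF db, THEN DERIV_cong]) (auto intro!: derivative_eq_intros)
    have d\<beta>1: "(\<beta>1 has_real_derivative \<beta>2 x) (at x)" for x
      unfolding \<beta>2_def \<beta>1_def by (rule DERIV_chain2[OF db1, THEN DERIV_cong]) (auto intro!: derivative_eq_intros)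
    have c\<beta>: "continuous_on A \<beta>" and c\<beta>1: "continuous_on A \<beta>1" for A
      using d\<beta> d\<beta>1 DERIV_continuous_on has_field_derivative_at_within by blast+
    have c\<beta>2: "continuous_on A \<beta>2" for A
      unfolding \<beta>2_def by (rule continuous_on_compose2[OF cb2]) (auto intro!: continuous_intros)
    have supp': "\<beta> x = 0" "\<beta>1 x = 0" if "x \<notin> {R<..<R+1}" for x
      using supp[of "x - R"] that by (auto simp: \<beta>_def \<beta>1_def)
    note cf = sturm_continuous(1)[OF f] and cf' = sturm_continuous(2)[OF f]
      and cg = sturm_continuous(1)[OF g] and cg' = sturm_continuous(2)[OF g]
      and df = sturm_deriv[OF f] and dg = sturm_deriv[OF g]
    have cF': "continuous_on A F" and cH': "continuous_on A H" for A
      using cF cH continuous_on_subset by blast+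
    note cs = cf cf' cg cg' cF' cH' c\<beta> c\<beta>1 c\<beta>2
    have cS: "continuous_on A S" for A unfolding S_def by (intro continuous_intros cs)
    have cW: "continuous_on A W" for A unfolding W_def by (intro continuous_intros cs)
    let ?I = "integral {R..R+1}"
    define \<tau> where "\<tau> = ?I S"
    have BB: "(\<beta> x)\<^sup>2 \<le> B\<^sup>2" "(\<beta>1 x)\<^sup>2 \<le> B\<^sup>2" "(\<beta>2 x)\<^sup>2 \<le> B\<^sup>2" for x
      using B[of "x - R"] by (auto simp: \<beta>_def \<beta>1_def \<beta>2_def abs_le_square_iff[symmetric])
    have ab2: "\<bar>2 * (u * v)\<bar> \<le> u\<^sup>2 + v\<^sup>2" for u v :: real
      using sum_squares_bound[of u v] sum_squares_bound[of u "- v"] by (auto simp: abs_le_iff)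
    have main: "2 * t * ?I (\<lambda>x. (\<beta>1 x)\<^sup>2 * W x) \<le> (6 + 2 * \<bar>C\<bar>) * B\<^sup>2 * \<tau>" if t: "t = 1 \<or> t = -1" for t
    proof -
      have t2: "t\<^sup>2 = 1" using t by auto
      define h where "h = (\<lambda>x. \<beta>1 x * f x + t * (\<beta> x * g x))"
      define h' where "h' = (\<lambda>x. \<beta>2 x * f x + \<beta>1 x * f' x + t * (\<beta>1 x * g x + \<beta> x * g' x))"
      define P where "P = (\<lambda>x. (\<beta>1 x)\<^sup>2 * f x)"
      define P' where "P' = (\<lambda>x. 2 * \<beta>1 x * \<beta>2 x * f x + (\<beta>1 x)\<^sup>2 * f' x)"
      define Q where "Q = (\<lambda>x. 2 * t * (\<beta>1 x * \<beta> x * f x) + t\<^sup>2 * ((\<beta> x)\<^sup>2 * g x))"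
      define Q' where "Q' = (\<lambda>x. 2 * t * (\<beta>2 x * \<beta> x * f x + (\<beta>1 x)\<^sup>2 * f x + \<beta>1 x * \<beta> x * f' x)
          + t\<^sup>2 * (2 * \<beta> x * \<beta>1 x * g x + (\<beta> x)\<^sup>2 * g' x))"
      define D where "D = (\<lambda>x. ((q x * f x - F x) * P x + f' x * P' x) + ((q x * g x - H x) * Q x + g' x * Q' x))"
      define r where "r = (\<lambda>x. (\<beta>2 x)\<^sup>2 * (f x)\<^sup>2 + (\<beta>1 x)\<^sup>2 * (f x * F x) + t\<^sup>2 * ((\<beta>1 x)\<^sup>2 * (g x)\<^sup>2 + (\<beta> x)\<^sup>2 * (g x * H x))
          + 2 * t * (\<beta>2 x * \<beta>1 x * (f x * g x)) + 2 * t * (\<beta>1 x * \<beta> x * (f x * H x)))"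
      have dh: "(h has_real_derivative h' x) (at x)" for x
        unfolding h_def h'_def by (rule derivative_eq_intros d\<beta> d\<beta>1 df dg refl)+ (simp add: algebra_simps)
      have dP: "(P has_real_derivative P' x) (at x)" for x
        unfolding P_def P'_def by (rule derivative_eq_intros d\<beta> d\<beta>1 df dg refl)+ (simp add: algebra_simps)
      have dQ: "(Q has_real_derivative Q' x) (at x)" for x
        unfolding Q_def Q'_def by (rule derivative_eq_intros d\<beta> d\<beta>1 df dg refl)+ (simp add: algebra_simps power2_eq_square)
      have ch: "continuous_on A h" and ch': "continuous_on A h'" for A
        unfolding h_def h'_def by (intro continuous_intros cs)+
      have cP': "continuous_on A P'" and cQ': "continuous_on A Q'" and cr: "continuous_on A r" for A
        unfolding P'_def Q'_def r_def by (intro continuous_intros cs)+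
      have "indef D (\<lambda>x. f' x * P x + g' x * Q x)"
        unfolding D_def by (intro indef_add indef_mult sturm_indef[OF f] sturm_indef[OF g] dP dQ cP' cQ')
      from indef_int[OF this, of R "R + 1"] have D0: "(D has_integral 0) {R..R+1}"
        using supp'[of R] supp'[of "R + 1"] by (simp add: P_def Q_def)
      have split: "(h' x)\<^sup>2 + q x * (h x)\<^sup>2 = D x + (r x - 2 * t * ((\<beta>1 x)\<^sup>2 * W x))" for x
        unfolding h_def h'_def P_def P'_def Q_def Q'_def D_def r_def W_def by algebra
      have hz: "h x = 0" if "x \<notin> {R<..<R+1}" for x using supp'[OF that] by (simp add: h_def)
      have hz': "h' x = 0" if "x \<notin> {R..R+1}" for x
      proof -
        have "open (- {R..R+1})" by (simp add: open_Compl)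
        moreover have "((\<lambda>_. 0) has_real_derivative 0) (at x)" by simp
        ultimately have "(h has_real_derivative 0) (at x)"
          using that hz by (intro has_field_derivative_transform_within_open[of "\<lambda>_. 0" 0 x "- {R..R+1}" h]) auto
        then show ?thesis using dh DERIV_unique by blast
      qed
      have si: "set_integrable lborel {R..R+1} (\<lambda>x. (h' x)\<^sup>2 + q x * (h x)\<^sup>2)"
      proof (rule set_integral_add(1))
        show "set_integrable lborel {R..R+1} (\<lambda>x. (h' x)\<^sup>2)"
          by (intro set_integrable_lborel_continuous continuous_intros ch')
        show "set_integrable lborel {R..R+1} (\<lambda>x. q x * (h x)\<^sup>2)"
          using q unfolding locally_integrable_def
          by (intro set_integrable_lborel_mult_continuous continuous_intros ch) auto
      qed
      have "C * (\<integral>x. (h x)\<^sup>2 \<partial>lborel) \<le> (\<integral>x. (h' x)\<^sup>2 + q x * (h x)\<^sup>2 \<partial>lborel)"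
      proof (rule C[OF dh ch'])
        show "\<exists>r. \<forall>x. \<bar>x\<bar> > r \<longrightarrow> h x = 0"
          by (rule exI[of _ "\<bar>R\<bar> + 1"]) (auto intro!: hz)
      qed
      also have "(\<integral>x. (h' x)\<^sup>2 + q x * (h x)\<^sup>2 \<partial>lborel) = ?I (\<lambda>x. (h' x)\<^sup>2 + q x * (h x)\<^sup>2)"
        by (rule lborel_integral_supported[OF si]) (use hz hz' in auto)
      also have "(\<integral>x. (h x)\<^sup>2 \<partial>lborel) = ?I (\<lambda>x. (h x)\<^sup>2)"
        by (rule lborel_integral_supported)
           (use hz in \<open>auto intro!: set_integrable_lborel_continuous continuous_intros ch\<close>)
      also have "?I (\<lambda>x. (h' x)\<^sup>2 + q x * (h x)\<^sup>2) = ?I (\<lambda>x. r x - 2 * t * ((\<beta>1 x)\<^sup>2 * W x))"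
      proof -
        have "((\<lambda>x. D x + (r x - 2 * t * ((\<beta>1 x)\<^sup>2 * W x))) has_integral 0 + ?I (\<lambda>x. r x - 2 * t * ((\<beta>1 x)\<^sup>2 * W x))) {R..R+1}"
          by (intro has_integral_add D0 integrable_integral integrable_continuous_real continuous_intros cr cW cs)
        then show ?thesis unfolding split by (simp add: integral_unique)
      qed
      also have "\<dots> = ?I r - 2 * t * ?I (\<lambda>x. (\<beta>1 x)\<^sup>2 * W x)"
        by (subst Henstock_Kurzweil_Integration.integral_diff)
           (auto intro!: integrable_continuous_real continuous_intros cr cW cs)
      finally have "2 * t * ?I (\<lambda>x. (\<beta>1 x)\<^sup>2 * W x) \<le> ?I r - C * ?I (\<lambda>x. (h x)\<^sup>2)" by simp
      also have "\<dots> = ?I (\<lambda>x. r x - C * (h x)\<^sup>2)"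
        by (subst Henstock_Kurzweil_Integration.integral_diff)
           (auto intro!: integrable_continuous_real continuous_intros cr ch)
      \<comment> \<open>Each of the six terms of \<open>r\<close> is at most
        \<open>B\<^sup>2 * S x\<close>, and \<open>(h x)\<^sup>2\<close> is at most twice that,
        which gives the factor \<open>6 + 2 * \<bar>C\<bar>\<close>.\<close>
      also have "\<dots> \<le> ?I (\<lambda>x. (6 + 2 * \<bar>C\<bar>) * B\<^sup>2 * S x)"
      proof (intro integral_le integrable_continuous_real continuous_intros cr ch cS)
        fix x
        have S0: "0 \<le> S x" by (simp add: S_def)
        have am: "\<bar>u * v\<bar> \<le> B\<^sup>2" if "u\<^sup>2 \<le> B\<^sup>2" "v\<^sup>2 \<le> B\<^sup>2" for u v
          using sum_squares_bound[of u v] sum_squares_bound[of u "-v"] that by (auto simp: abs_le_iff)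
        have aS: "\<bar>2 * (f x * g x)\<bar> \<le> S x" "\<bar>2 * (f x * H x)\<bar> \<le> S x" "\<bar>2 * (f x * F x)\<bar> \<le> S x" "\<bar>2 * (g x * H x)\<bar> \<le> S x"
          using ab2[of "f x" "g x"] ab2[of "f x" "H x"] ab2[of "f x" "F x"] ab2[of "g x" "H x"]
            zero_le_power2[of "f x"] zero_le_power2[of "F x"] zero_le_power2[of "g x"] zero_le_power2[of "H x"]
          unfolding S_def by linarith+
        have pr: "u * v \<le> B\<^sup>2 * S x" if "\<bar>u\<bar> \<le> B\<^sup>2" "\<bar>v\<bar> \<le> S x" for u v
        proof -
          have "u * v \<le> \<bar>u\<bar> * \<bar>v\<bar>" by (metis abs_ge_self abs_mult)
          also have "\<dots> \<le> B\<^sup>2 * S x" using that by (intro mult_mono) auto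
          finally show ?thesis .
        qed
        have sS: "\<bar>(f x)\<^sup>2\<bar> \<le> S x" "\<bar>(g x)\<^sup>2\<bar> \<le> S x" by (auto simp: S_def)
        have at: "\<bar>t\<bar> = 1" using t by auto
        have 1: "(\<beta>2 x)\<^sup>2 * (f x)\<^sup>2 \<le> B\<^sup>2 * S x" using BB sS by (intro pr) auto
        have 2: "(\<beta>1 x)\<^sup>2 * (f x * F x) \<le> B\<^sup>2 * S x" using BB aS(3) by (intro pr) auto
        have 3: "(\<beta>1 x)\<^sup>2 * (g x)\<^sup>2 \<le> B\<^sup>2 * S x" using BB sS by (intro pr) auto
        have 4: "(\<beta> x)\<^sup>2 * (g x * H x) \<le> B\<^sup>2 * S x" using BB aS(4) by (intro pr) auto
        have 5: "(t * (\<beta>2 x * \<beta>1 x)) * (2 * (f x * g x)) \<le> B\<^sup>2 * S x"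
          using am[OF BB(3) BB(2), of x x] aS(1) by (intro pr) (simp_all add: abs_mult[of t] at)
        have 6: "(t * (\<beta>1 x * \<beta> x)) * (2 * (f x * H x)) \<le> B\<^sup>2 * S x"
          using am[OF BB(2) BB(1), of x x] aS(2) by (intro pr) (simp_all add: abs_mult[of t] at)
        have h2: "(h x)\<^sup>2 \<le> 2 * (B\<^sup>2 * S x)"
        proof -
          have "(h x)\<^sup>2 = (\<beta>1 x * f x)\<^sup>2 + t\<^sup>2 * (\<beta> x * g x)\<^sup>2 + 2 * (\<beta>1 x * f x) * (t * (\<beta> x * g x))"
            unfolding h_def by algebra
          also have "\<dots> \<le> 2 * ((\<beta>1 x)\<^sup>2 * (f x)\<^sup>2 + (\<beta> x)\<^sup>2 * (g x)\<^sup>2)"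
            using sum_squares_bound[of "\<beta>1 x * f x" "t * (\<beta> x * g x)"] t2 by (simp add: power_mult_distrib)
          also have "\<dots> \<le> 2 * (B\<^sup>2 * (f x)\<^sup>2 + B\<^sup>2 * (g x)\<^sup>2)"
            using BB by (intro mult_left_mono add_mono mult_right_mono) auto
          also have "\<dots> = 2 * (B\<^sup>2 * ((f x)\<^sup>2 + (g x)\<^sup>2))" by (simp add: algebra_simps)
          also have "\<dots> \<le> 2 * (B\<^sup>2 * S x)"
            by (intro mult_left_mono) (auto simp: S_def)
          finally show ?thesis .
        qed
        have 7: "- (C * (h x)\<^sup>2) \<le> \<bar>C\<bar> * (2 * (B\<^sup>2 * S x))"
        proof -
          have "- (C * (h x)\<^sup>2) \<le> \<bar>C\<bar> * (h x)\<^sup>2" 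
            using mult_right_mono[of "- C" "\<bar>C\<bar>" "(h x)\<^sup>2"] by simp
          also have "\<dots> \<le> \<bar>C\<bar> * (2 * (B\<^sup>2 * S x))" using h2 by (intro mult_left_mono) auto
          finally show ?thesis .
        qed
        show "r x - C * (h x)\<^sup>2 \<le> (6 + 2 * \<bar>C\<bar>) * B\<^sup>2 * S x"
          using 1 2 3 4 5 6 7 unfolding r_def t2 by (simp add: algebra_simps)
      qed
      also have "\<dots> = (6 + 2 * \<bar>C\<bar>) * B\<^sup>2 * \<tau>" by (simp add: \<tau>_def)
      finally show ?thesis .
    qed
    have "\<bar>?I (\<lambda>x. (\<beta>1 x)\<^sup>2 * W x)\<bar> \<le> (3 + \<bar>C\<bar>) * B\<^sup>2 * \<tau>"
      using main[of 1] main[of "-1"] by (auto simp: abs_le_iff algebra_simps)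
    moreover have "?I (\<lambda>x. (\<beta>1 x)\<^sup>2) = K"
    proof -
      have "((\<lambda>x. (b1 x)\<^sup>2) has_integral K) {0..1}"
        unfolding K_def using db1 by (intro integrable_integral integrable_continuous_real continuous_intros)
           (use DERIV_continuous_on has_field_derivative_at_within in blast)
      then have "(((\<lambda>x. (\<beta>1 x)\<^sup>2) \<circ> ((+) R)) has_integral K) {0..1}"
        by (simp add: o_def \<beta>1_def)
      then show ?thesis
        unfolding has_integral_shift_Icc_real by (simp add: integral_unique add.commute)
    qed
    \<comment> \<open>Lagrange's identity bounds the oscillation of \<open>W\<close> over the
      interval by \<tau>, which turns the bound on the weighted average into one at the single point
      \<open>R\<close>.\<close>
    moreover have WR: "\<bar>W x - W R\<bar> \<le> \<tau>" if x: "x \<in> {R..R+1}" for x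
    proof -
      have "((\<lambda>x. F x * g x - f x * H x) has_integral (W x - W R)) {R..x}"
        unfolding W_def by (rule indef_int[OF sturm_wronskian[OF f g]]) (use x in auto)
      then have "W x - W R = integral {R..x} (\<lambda>x. F x * g x - f x * H x)" by (simp add: integral_unique)
      also have "norm \<dots> \<le> integral {R..x} S"
      proof (intro integral_norm_bound_integral integrable_continuous_real continuous_intros cs cS)
        fix y
        show "norm (F y * g y - f y * H y) \<le> S y"
          using ab2[of "F y" "g y"] ab2[of "f y" "H y"]
            zero_le_power2[of "f y"] zero_le_power2[of "F y"] zero_le_power2[of "g y"] zero_le_power2[of "H y"]
          unfolding S_def real_norm_def by linarith
      qed
      also have "\<dots> \<le> \<tau>"
        unfolding \<tau>_def using x by (intro integral_subset_le integrable_continuous_real cS) (auto simp: S_def)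
      finally show ?thesis by simp
    qed
    moreover have "\<bar>W R * K - ?I (\<lambda>x. (\<beta>1 x)\<^sup>2 * W x)\<bar> \<le> K * \<tau>"
    proof -
      have "?I (\<lambda>x. (\<beta>1 x)\<^sup>2 * W R - (\<beta>1 x)\<^sup>2 * W x) = W R * K - ?I (\<lambda>x. (\<beta>1 x)\<^sup>2 * W x)"
        unfolding \<open>?I (\<lambda>x. (\<beta>1 x)\<^sup>2) = K\<close>[symmetric]
        by (subst Henstock_Kurzweil_Integration.integral_diff)
           (auto intro!: integrable_continuous_real continuous_intros cs cW simp: mult.commute)
      moreover have "norm (?I (\<lambda>x. (\<beta>1 x)\<^sup>2 * W R - (\<beta>1 x)\<^sup>2 * W x)) \<le> ?I (\<lambda>x. (\<beta>1 x)\<^sup>2 * \<tau>)"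
      proof (intro integral_norm_bound_integral integrable_continuous_real continuous_intros cs cW)
        fix x assume "x \<in> {R..R+1}"
        from WR[OF this] show "norm ((\<beta>1 x)\<^sup>2 * W R - (\<beta>1 x)\<^sup>2 * W x) \<le> (\<beta>1 x)\<^sup>2 * \<tau>"
          by (simp add: right_diff_distrib[symmetric] abs_mult abs_minus_commute mult_left_mono)
      qed
      ultimately show ?thesis using \<open>?I (\<lambda>x. (\<beta>1 x)\<^sup>2) = K\<close> by simp
    qed
    ultimately have "\<bar>W R * K\<bar> \<le> K * \<tau> + (3 + \<bar>C\<bar>) * B\<^sup>2 * \<tau>" by linarith
    then have "\<bar>W R\<bar> * K \<le> K * \<tau> + (3 + \<bar>C\<bar>) * B\<^sup>2 * \<tau>" using K0 by (simp add: abs_mult)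
    then have "\<bar>W R\<bar> \<le> (1 + (3 + \<bar>C\<bar>) * B\<^sup>2 / K) * \<tau>" using K0 by (simp add: field_simps)
    then show "\<bar>f R * g' R - f' R * g R\<bar> \<le> (1 + (3 + \<bar>C\<bar>) * B\<^sup>2 / K) *
        ?I (\<lambda>x. (f x)\<^sup>2 + (F x)\<^sup>2 + (g x)\<^sup>2 + (H x)\<^sup>2)"
      by (simp add: W_def \<tau>_def S_def)
  qed
qed

section \<open>Square integrable solutions\<close>

definition cumint :: "(real \<Rightarrow> real) \<Rightarrow> real \<Rightarrow> real" where
  "cumint g x = (LINT s:{..x}|lborel. g s)"

lemma set_integrable_of_integrable:
  fixes g :: "real \<Rightarrow> real"
  assumes "integrable lborel g" "A \<in> sets lborel"
  shows "set_integrable lborel A g"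
  using integrable_mult_indicator[OF assms(2,1)] by (simp add: set_integrable_def)

lemma cumint_diff:
  assumes "integrable lborel g" "x \<le> y"
  shows "cumint g y - cumint g x = integral {x..y} g"
proof -
  have "(LINT s:{..x} \<union> {x<..y}|lborel. g s) = cumint g x + (LINT s:{x<..y}|lborel. g s)"
    unfolding cumint_def by (intro set_integral_Un set_integrable_of_integrable assms) auto
  moreover have "{..x} \<union> {x<..y} = {..y}" using assms(2) by auto
  moreover have "(LINT s:{x<..y}|lborel. g s) = integral {x<..y} g"
    by (intro set_borel_integral_eq_integral set_integrable_of_integrable assms) auto
  moreover have "integral {x<..y} g = integral {x..y} g"
    by (rule integral_spike_set) (auto intro: negligible_subset[of "{x}"])
  ultimately show ?thesis by (simp add: cumint_def)
qed

lemma cumint_deriv: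
  assumes "continuous_on UNIV g" "integrable lborel g"
  shows "(cumint g has_real_derivative g x) (at x)"
proof -
  have "indef g (cumint g)"
  proof (rule indefI)
    fix a b :: real assume "a \<le> b"
    show "g absolutely_integrable_on {a..b}"
      using assms(1) by (intro absolutely_integrable_continuous_real) (rule continuous_on_subset, auto)
    then show "(g has_integral cumint g b - cumint g a) {a..b}"
      unfolding cumint_diff[OF assms(2) \<open>a \<le> b\<close>]
      by (intro integrable_integral) (rule set_lebesgue_integral_eq_integral)
  qed
  then show ?thesis using assms(1) by (rule indef_deriv)
qed

lemma cumint_at_bot:
  assumes "integrable lborel g" shows "(cumint g \<longlongrightarrow> 0) at_bot"
proof -
  have "((\<lambda>a. set_lebesgue_integral lborel {a..0} g) \<longlongrightarrow> cumint g 0) at_bot"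
    unfolding cumint_def
    by (intro tendsto_set_lebesgue_integral_at_bot set_integrable_of_integrable assms) auto
  then have "((\<lambda>a. cumint g 0 - set_lebesgue_integral lborel {a..0} g) \<longlongrightarrow> cumint g 0 - cumint g 0) at_bot"
    by (intro tendsto_intros)
  moreover have "\<forall>\<^sub>F a in at_bot. cumint g 0 - set_lebesgue_integral lborel {a..0} g = cumint g a"
    using eventually_le_at_bot[of 0]
  proof eventually_elim
    case (elim a)
    have "set_lebesgue_integral lborel {a..0} g = integral {a..0} g"
      by (intro set_borel_integral_eq_integral set_integrable_of_integrable assms) auto
    then show ?case using cumint_diff[OF assms elim] by simp
  qed
  ultimately show ?thesis by (simp add: filterlim_cong)
qed

lemma cumint_at_top:
  assumes "integrable lborel g" shows "(cumint g \<longlongrightarrow> (LINT x|lborel. g x)) at_top"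
  using tendsto_integral_at_top[OF _ assms] by (simp add: cumint_def[abs_def] set_lebesgue_integral_def)

text \<open>Monotone convergence along the intervals from -n to n. This is how energy bounds on
  compact intervals become square integrability on the line.\<close>

lemma integrable_of_bounded_integrals:
  fixes g :: "real \<Rightarrow> real"
  assumes c: "continuous_on UNIV g" and nn: "\<And>x. 0 \<le> g x"
    and K: "\<And>a b. a \<le> b \<Longrightarrow> integral {a..b} g \<le> K"
  shows "integrable lborel g"
proof -
  have si: "set_integrable lborel {a..b} g" for a b
    by (rule set_integrable_lborel_continuous[OF c])
  have int: "integrable lborel (\<lambda>x. indicator {- real n..real n} x *\<^sub>R g x)" for n
    using si by (simp add: set_integrable_def)
  have val: "(LINT x|lborel. indicator {- real n..real n} x *\<^sub>R g x) = integral {- real n..real n} g" for n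
    using set_borel_integral_eq_integral(2)[OF si] by (simp add: set_lebesgue_integral_def)
  have inc: "incseq (\<lambda>n. integral {- real n..real n} g)"
    using c nn by (intro incseq_SucI integral_subset_le integrable_continuous_real)
      (auto intro: continuous_on_subset)
  obtain L where L: "(\<lambda>n. integral {- real n..real n} g) \<longlonglongrightarrow> L"
  proof -
    have "integral {- real n..real n} g \<le> K" for n by (rule K) simp
    then show ?thesis using that incseq_convergent[OF inc, of K] by blast
  qed
  show ?thesis
  proof (rule integrable_monotone_convergence[OF int])
    show "AE x in lborel. mono (\<lambda>n. indicator {- real n..real n} x *\<^sub>R g x)"
      using nn by (intro AE_I2 monoI) (auto simp: indicator_def)
    show "AE x in lborel. (\<lambda>n. indicator {- real n..real n} x *\<^sub>R g x) \<longlonglongrightarrow> g x"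
    proof (intro AE_I2)
      fix x :: real
      have "\<forall>\<^sub>F n in sequentially. indicator {- real n..real n} x *\<^sub>R g x = g x"
        by (rule eventually_sequentiallyI[of "nat \<lceil>\<bar>x\<bar>\<rceil>"]) (auto simp: indicator_def nat_le_iff ceiling_le_iff)
      then show "(\<lambda>n. indicator {- real n..real n} x *\<^sub>R g x) \<longlonglongrightarrow> g x"
        by (rule tendsto_eventually)
    qed
    show "(\<lambda>n. LINT x|lborel. indicator {- real n..real n} x *\<^sub>R g x) \<longlonglongrightarrow> L"
      unfolding val by (rule L)
    show "g \<in> borel_measurable lborel"
      using borel_measurable_continuous_onI[OF c] by simp
  qed
qed

lemma integral_le_LINT:
  fixes g :: "real \<Rightarrow> real"
  assumes "integrable lborel g" "\<And>x. 0 \<le> g x"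
  shows "integral {a..b} g \<le> (LINT x|lborel. g x)"
proof -
  have "integral {a..b} g = (LINT x:{a..b}|lborel. g x)"
    by (intro set_borel_integral_eq_integral(2)[symmetric] set_integrable_of_integrable assms) auto
  also have "\<dots> \<le> (LINT x|lborel. g x)"
    unfolding set_lebesgue_integral_def using assms
    by (intro integral_mono integrable_mult_indicator) (auto simp: indicator_def)
  finally show ?thesis .
qed

lemma LINT_square_eq_0:
  fixes g :: "real \<Rightarrow> real"
  assumes c: "continuous_on UNIV g" and i: "integrable lborel (\<lambda>x. (g x)\<^sup>2)"
    and z: "(LINT x|lborel. (g x)\<^sup>2) = 0"
  shows "g x = 0"
proof -
  have c2: "continuous_on A (\<lambda>x. (g x)\<^sup>2)" for A
    using c by (intro continuous_intros) (rule continuous_on_subset, auto)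
  have "integral {x-1..x+1} (\<lambda>x. (g x)\<^sup>2) \<le> 0"
    using integral_le_LINT[OF i] z by simp
  moreover have "integral {x-1..x+1} (\<lambda>x. (g x)\<^sup>2) \<ge> 0"
    by (intro integral_nonneg integrable_continuous_real c2) auto
  ultimately have "((\<lambda>x. (g x)\<^sup>2) has_integral 0) (cbox (x-1) (x+1))"
    using integrable_continuous_real[OF c2] by (simp add: has_integral_integrable_integral)
  then have "(g x)\<^sup>2 = 0"
    by (rule has_integral_0_cbox_imp_0[rotated 2]) (auto intro: c2)
  then show ?thesis by simp
qed

lemma integrable_mult_of_squares:
  fixes f g :: "real \<Rightarrow> real"
  assumes "continuous_on UNIV f" "continuous_on UNIV g"
    and "integrable lborel (\<lambda>x. (f x)\<^sup>2)" "integrable lborel (\<lambda>x. (g x)\<^sup>2)"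
  shows "integrable lborel (\<lambda>x. f x * g x)"
proof (rule Bochner_Integration.integrable_bound)
  show "integrable lborel (\<lambda>x. (f x)\<^sup>2 + (g x)\<^sup>2)" using assms by simp
  have "continuous_on UNIV (\<lambda>x. f x * g x)" by (intro continuous_intros assms)
  then show "(\<lambda>x. f x * g x) \<in> borel_measurable lborel"
    using borel_measurable_continuous_onI by auto
  show "AE x in lborel. norm (f x * g x) \<le> norm ((f x)\<^sup>2 + (g x)\<^sup>2)"
  proof (intro AE_I2)
    fix x
    show "norm (f x * g x) \<le> norm ((f x)\<^sup>2 + (g x)\<^sup>2)"
      using sum_squares_bound[of "f x" "g x"] sum_squares_bound[of "f x" "- g x"]
        zero_le_power2[of "f x"] zero_le_power2[of "g x"]
      unfolding real_norm_def by (simp add: abs_le_iff)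
  qed
qed

lemma integrable_square_add:
  fixes f g :: "real \<Rightarrow> real"
  assumes "continuous_on UNIV f" "continuous_on UNIV g"
    and "integrable lborel (\<lambda>x. (f x)\<^sup>2)" "integrable lborel (\<lambda>x. (g x)\<^sup>2)"
  shows "integrable lborel (\<lambda>x. (a * f x + b * g x)\<^sup>2)"
proof -
  have "integrable lborel (\<lambda>x. a\<^sup>2 * (f x)\<^sup>2 + b\<^sup>2 * (g x)\<^sup>2 + (2 * a * b) * (f x * g x))"
    by (intro Bochner_Integration.integrable_add integrable_mult_right integrable_mult_of_squares assms)
  moreover have "a\<^sup>2 * (f x)\<^sup>2 + b\<^sup>2 * (g x)\<^sup>2 + (2 * a * b) * (f x * g x) = (a * f x + b * g x)\<^sup>2" for x
    by algebra
  ultimately show ?thesis by simp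
qed

text \<open>The bound over \<open>{R..R+1}\<close> is \<open>M\<close> times an increment of the
  function \<open>cumint S\<close>, which converges at both ends. The right-hand sides are arbitrary
  square integrable functions so that a solution with a leftover inhomogeneous term is
  covered.\<close>

lemma wronskian_tendsto_0:
  assumes "locally_integrable q" "semibounded_below q"
    and f: "sturm q F f f'" and g: "sturm q H g g'"
    and cF: "continuous_on UNIV F" and cH: "continuous_on UNIV H"
    and i: "integrable lborel (\<lambda>x. (f x)\<^sup>2)" "integrable lborel (\<lambda>x. (F x)\<^sup>2)"
      "integrable lborel (\<lambda>x. (g x)\<^sup>2)" "integrable lborel (\<lambda>x. (H x)\<^sup>2)"
  shows "((\<lambda>x. f x * g' x - f' x * g x) \<longlongrightarrow> 0) at_bot"
    and "((\<lambda>x. f x * g' x - f' x * g x) \<longlongrightarrow> 0) at_top"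
proof -
  define S where "S = (\<lambda>x. (f x)\<^sup>2 + (F x)\<^sup>2 + (g x)\<^sup>2 + (H x)\<^sup>2)"
  have Si: "integrable lborel S" unfolding S_def by (intro Bochner_Integration.integrable_add i)
  obtain M where M: "\<bar>f R * g' R - f' R * g R\<bar> \<le> M * integral {R..R+1} S" for R
  proof -
    obtain M where "\<And>f f' F g g' H R. \<lbrakk>sturm q F f f'; sturm q H g g';
      continuous_on UNIV F; continuous_on UNIV H\<rbrakk> \<Longrightarrow>
      \<bar>f R * g' R - f' R * g R\<bar> \<le>
        M * integral {R..R+1} (\<lambda>x. (f x)\<^sup>2 + (F x)\<^sup>2 + (g x)\<^sup>2 + (H x)\<^sup>2)"
      using semibounded_wronskian_bound[OF assms(1,2)] by blast
    note * = this[OF f g cF cH]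
    show thesis by (rule that[of M]) (use * in \<open>simp add: S_def\<close>)
  qed
  have b: "\<forall>\<^sub>F R in A. norm (f R * g' R - f' R * g R) \<le> M * (cumint S (R + 1) - cumint S R)" for A
    using M cumint_diff[OF Si] by (intro always_eventually) auto
  have "filterlim (\<lambda>R::real. R + 1) at_bot at_bot"
    unfolding filterlim_at_bot eventually_at_bot_linorder by (metis add.commute le_diff_eq)
  moreover have "filterlim (\<lambda>R::real. R + 1) at_top at_top"
    unfolding filterlim_at_top eventually_at_top_linorder by (metis add.commute diff_le_eq)
  ultimately have sh: "((\<lambda>R. cumint S (R + 1)) \<longlongrightarrow> 0) at_bot"
      "((\<lambda>R. cumint S (R + 1)) \<longlongrightarrow> integral\<^sup>L lborel S) at_top"
    using filterlim_compose[OF cumint_at_bot[OF Si]] filterlim_compose[OF cumint_at_top[OF Si]] by blast+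
  have "((\<lambda>R. M * (cumint S (R + 1) - cumint S R)) \<longlongrightarrow> M * (0 - 0)) at_bot"
    by (intro tendsto_intros sh cumint_at_bot Si)
  then show "((\<lambda>x. f x * g' x - f' x * g x) \<longlongrightarrow> 0) at_bot"
    by (intro Lim_null_comparison[OF b]) simp
  have "((\<lambda>R. M * (cumint S (R + 1) - cumint S R)) \<longlongrightarrow> M * (integral\<^sup>L lborel S - integral\<^sup>L lborel S)) at_top"
    by (intro tendsto_intros sh cumint_at_top Si)
  then show "((\<lambda>x. f x * g' x - f' x * g x) \<longlongrightarrow> 0) at_top"
    by (intro Lim_null_comparison[OF b]) simp
qed

lemma antideriv_unique:
  fixes f g :: "real \<Rightarrow> real"
  assumes "\<And>x. (f has_real_derivative h x) (at x)" "\<And>x. (g has_real_derivative h x) (at x)"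
    and "(f \<longlongrightarrow> l) F" "(g \<longlongrightarrow> l) F" "F \<noteq> bot"
  shows "f x = g x"
proof -
  have "((\<lambda>x. f x - g x) has_real_derivative 0) (at x)" for x
    using assms(1)[of x] assms(2)[of x] by (auto intro!: derivative_eq_intros)
  then have "f y - g y = f x - g x" for y
    using DERIV_isconst_all[of "\<lambda>x. f x - g x"] by blast
  then have "(\<lambda>y. f y - g y) = (\<lambda>_. f x - g x)" by blast
  then have "((\<lambda>y. f y - g y) \<longlongrightarrow> f x - g x) F" by simp
  moreover have "((\<lambda>y. f y - g y) \<longlongrightarrow> l - l) F" by (intro tendsto_intros assms)
  ultimately show ?thesis using tendsto_unique[OF assms(5)] by fastforce
qed

text \<open>Lagrange's identity integrated from -infinity, where the Wronskian vanishes; its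
  vanishing at +infinity gives the second claim. The first fixes constants of integration, the
  second yields orthogonality of eigenfunctions.\<close>

lemma wronskian_eq_cumint:
  assumes "locally_integrable q" "semibounded_below q"
    and f: "sturm q F f f'" and g: "sturm q H g g'"
    and cF: "continuous_on UNIV F" and cH: "continuous_on UNIV H"
    and i: "integrable lborel (\<lambda>x. (f x)\<^sup>2)" "integrable lborel (\<lambda>x. (F x)\<^sup>2)"
      "integrable lborel (\<lambda>x. (g x)\<^sup>2)" "integrable lborel (\<lambda>x. (H x)\<^sup>2)"
  shows "f x * g' x - f' x * g x = cumint (\<lambda>x. F x * g x - f x * H x) x"
    and "(LINT x|lborel. F x * g x - f x * H x) = 0"
proof -
  let ?h = "\<lambda>x. F x * g x - f x * H x"
  note w = wronskian_tendsto_0[OF assms]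
  note c = sturm_continuous(1)[OF f] sturm_continuous(1)[OF g]
  have ch: "continuous_on UNIV ?h" by (intro continuous_intros cF cH c)
  have ih: "integrable lborel ?h"
    by (intro Bochner_Integration.integrable_diff integrable_mult_of_squares i cF cH c)
  have *: "f x * g' x - f' x * g x = cumint ?h x" for x
    by (rule antideriv_unique[where f="\<lambda>x. f x * g' x - f' x * g x" and l=0 and F=at_bot, OF
          indef_deriv[OF sturm_wronskian[OF f g] ch] cumint_deriv[OF ch ih] w(1) cumint_at_bot[OF ih]]) simp
  then show "f x * g' x - f' x * g x = cumint ?h x" .
  show "(LINT x|lborel. ?h x) = 0"
    using cumint_at_top[OF ih] w(2) unfolding * by (rule tendsto_unique[rotated]) simp
qed

section \<open>Double commutation\<close>

lemma has_vector_derivative_vec_nth: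
  fixes f :: "real \<Rightarrow> 'a::real_normed_vector^'n"
  assumes "(f has_vector_derivative f') F"
  shows "((\<lambda>t. f t $ i) has_vector_derivative f' $ i) F"
  by (rule bounded_linear.has_vector_derivative[OF bounded_linear_vec_nth assms])

lemma has_vector_derivative_vecI:
  fixes f :: "real \<Rightarrow> real^'n"
  assumes "\<And>i. ((\<lambda>t. f t $ i) has_real_derivative f' $ i) (at x)"
  shows "(f has_vector_derivative f') (at x)"
proof -
  have v: "y = (\<Sum>i\<in>UNIV. (y $ i) *\<^sub>R axis i 1)" for y :: "real^'n"
    by (simp add: vec_eq_iff axis_def if_distrib[of "\<lambda>z. _ * z"] cong: if_cong)
  have "((\<lambda>t. \<Sum>i\<in>UNIV. (f t $ i) *\<^sub>R axis i 1) has_vector_derivative (\<Sum>i\<in>UNIV. (f' $ i) *\<^sub>R (axis i 1 :: real^'n))) (at x)"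
    using assms
    by (intro has_vector_derivative_sum bounded_linear.has_vector_derivative[OF bounded_linear_scaleR_left])
       (simp add: has_real_derivative_iff_has_vector_derivative)
  then show ?thesis by (simp flip: v)
qed

lemma has_vector_derivative_matrixI:
  fixes M :: "real \<Rightarrow> real^'n^'m"
  assumes "\<And>i j. ((\<lambda>t. M t $ i $ j) has_real_derivative M' $ i $ j) (at x)"
  shows "(M has_vector_derivative M') (at x)"
proof -
  have v: "Y = (\<Sum>i\<in>UNIV. \<Sum>j\<in>UNIV. (Y $ i $ j) *\<^sub>R axis i (axis j 1))" for Y :: "real^'n^'m"
  proof -
    have *: "(\<Sum>j\<in>UNIV. if P then f j else 0) = (if P then \<Sum>j\<in>UNIV. f j else 0)"
      for P and f :: "'n \<Rightarrow> real" by simp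
    show ?thesis
      by (simp add: vec_eq_iff axis_def if_distrib[of "\<lambda>z. _ * z"] if_distrib[of "\<lambda>z. z $ _"] * cong: if_cong)
  qed
  have "((\<lambda>t. \<Sum>i\<in>UNIV. \<Sum>j\<in>UNIV. (M t $ i $ j) *\<^sub>R axis i (axis j 1)) has_vector_derivative
      (\<Sum>i\<in>UNIV. \<Sum>j\<in>UNIV. (M' $ i $ j) *\<^sub>R (axis i (axis j 1) :: real^'n^'m))) (at x)"
    using assms
    by (intro has_vector_derivative_sum bounded_linear.has_vector_derivative[OF bounded_linear_scaleR_left])
       (simp add: has_real_derivative_iff_has_vector_derivative)
  then show ?thesis by (simp flip: v)
qed

lemma has_real_derivative_vec_nth:
  fixes f :: "real \<Rightarrow> real^'n"
  assumes "(f has_vector_derivative f') (at x)"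
  shows "((\<lambda>t. f t $ i) has_real_derivative f' $ i) (at x)"
  using has_vector_derivative_vec_nth[OF assms] by (simp add: has_real_derivative_iff_has_vector_derivative)

lemma bounded_bilinear_matrix_vector_mult:
  "bounded_bilinear ((*v) :: real^'n^'m \<Rightarrow> real^'n \<Rightarrow> real^'m)"
  unfolding bilinear_conv_bounded_bilinear[symmetric] bilinear_def
  by (auto intro!: linearI simp: matrix_vector_mult_def vec_eq_iff sum.distrib sum_distrib_left algebra_simps)

lemma bounded_bilinear_matrix_matrix_mult:
  "bounded_bilinear ((**) :: real^'n^'m \<Rightarrow> real^'k^'n \<Rightarrow> real^'k^'m)"
  unfolding bilinear_conv_bounded_bilinear[symmetric] bilinear_def
  by (auto intro!: linearI simp: matrix_matrix_mult_def vec_eq_iff sum.distrib sum_distrib_left algebra_simps)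

lemmas has_vector_derivative_matrix_vector_mult =
  bounded_bilinear.has_vector_derivative[OF bounded_bilinear_matrix_vector_mult]

lemma has_real_derivative_inner:
  fixes f g :: "real \<Rightarrow> 'a::real_inner"
  assumes "(f has_vector_derivative f') (at x)" "(g has_vector_derivative g') (at x)"
  shows "((\<lambda>t. f t \<bullet> g t) has_real_derivative f x \<bullet> g' + f' \<bullet> g x) (at x)"
  using bounded_bilinear.has_vector_derivative[OF bounded_bilinear_inner assms]
  by (simp add: has_real_derivative_iff_has_vector_derivative)

lemma has_vector_derivative_continuous_on_UNIV:
  assumes "\<And>x. (f has_vector_derivative f' x) (at x)"
  shows "continuous_on S f"
  using assms has_vector_derivative_continuous continuous_at_imp_continuous_on by blast

definition outer :: "real^'n \<Rightarrow> real^'m \<Rightarrow> real^'m^'n" where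
  "outer a b = (\<chi> i j. a $ i * b $ j)"

lemma outer_mult_vec: "outer a b *v y = (b \<bullet> y) *\<^sub>R a"
  by (simp add: outer_def matrix_vector_mult_def vec_eq_iff inner_vec_def sum_distrib_right sum_distrib_left mult_ac)

text \<open>The product rule in the Leibniz formula; exchanging the sums over permutations and over
  the differentiated factor collects one determinant per row.\<close>

lemma det_has_real_derivative:
  fixes M :: "real \<Rightarrow> real^'n^'n"
  assumes "\<And>i j. ((\<lambda>t. M t $ i $ j) has_real_derivative D $ i $ j) (at x)"
  shows "((\<lambda>t. det (M t)) has_real_derivative (\<Sum>i\<in>UNIV. det (\<chi> k l. if k = i then D $ i $ l else M x $ k $ l))) (at x)"
proof -
  let ?P = "{p. p permutes (UNIV :: 'n set)}"
  have "((\<lambda>t. det (M t)) has_real_derivative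
      (\<Sum>p\<in>?P. of_int (sign p) * (\<Sum>i\<in>UNIV. D $ i $ p i * (\<Prod>j\<in>UNIV-{i}. M x $ j $ p j)))) (at x)"
    unfolding det_def by (intro DERIV_sum DERIV_cmult has_field_derivative_prod assms)
  also have "(\<Sum>p\<in>?P. of_int (sign p) * (\<Sum>i\<in>UNIV. D $ i $ p i * (\<Prod>j\<in>UNIV-{i}. M x $ j $ p j)))
     = (\<Sum>i\<in>UNIV. \<Sum>p\<in>?P. of_int (sign p) * (D $ i $ p i * (\<Prod>j\<in>UNIV-{i}. M x $ j $ p j)))"
    unfolding sum_distrib_left by (rule sum.swap)
  also have "\<dots> = (\<Sum>i\<in>UNIV. det (\<chi> k l. if k = i then D $ i $ l else M x $ k $ l))"
  proof (rule sum.cong[OF refl])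
    fix i :: 'n
    have "D $ i $ p i * (\<Prod>j\<in>UNIV-{i}. M x $ j $ p j) = (\<Prod>k\<in>UNIV. (if k = i then D $ i $ p k else M x $ k $ p k))" for p
      by (subst prod.remove[of UNIV i]) auto
    then show "(\<Sum>p\<in>?P. of_int (sign p) * (D $ i $ p i * (\<Prod>j\<in>UNIV-{i}. M x $ j $ p j)))
       = det (\<chi> k l. if k = i then D $ i $ l else M x $ k $ l)"
      by (simp add: det_def)
  qed
  finally show ?thesis .
qed

lemma matrix_inv_inverse:
  assumes "invertible M" shows "M ** matrix_inv M = mat 1" "matrix_inv M ** M = mat 1"
  using someI_ex[OF assms[unfolded invertible_def]] by (auto simp: matrix_inv_def)

text \<open>Cramer's rule writes each entry of the inverse as a quotient of determinants, which
  gives differentiability. The value of the derivative then follows from differentiating the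
  constant product of inverse and matrix.\<close>

lemma matrix_inv_has_vector_derivative:
  fixes G :: "real \<Rightarrow> real^'n^'n"
  assumes G: "\<And>x. (G has_vector_derivative G' x) (at x)"
    and inv: "\<And>x. invertible (G x)"
  shows "((\<lambda>x. matrix_inv (G x)) has_vector_derivative - (matrix_inv (G x) ** G' x ** matrix_inv (G x))) (at x)"
proof -
  let ?A = "\<lambda>x. matrix_inv (G x)"
  have GA: "G x ** ?A x = mat 1" and AG: "?A x ** G x = mat 1" for x
    using matrix_inv_inverse[OF inv] by auto
  have d0: "det (G x) \<noteq> 0" for x using inv invertible_det_nz by blast
  have entry: "?A y $ k $ j = det (\<chi> i l. if l = k then axis j 1 $ i else G y $ i $ l) / det (G y)" for y k j
  proof -
    have "G y *v (?A y *v axis j 1) = axis j 1"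
      by (simp add: matrix_vector_mul_assoc GA)
    then have "?A y *v axis j 1 = (\<chi> k. det (\<chi> i l. if l = k then axis j 1 $ i else G y $ i $ l) / det (G y))"
      using cramer[OF d0] by blast
    then have "(?A y *v axis j 1) $ k = det (\<chi> i l. if l = k then axis j 1 $ i else G y $ i $ l) / det (G y)"
      by simp
    then show ?thesis by (simp add: matrix_vector_mult_basis column_def)
  qed
  have dG: "((\<lambda>t. G t $ i $ j) has_real_derivative G' x $ i $ j) (at x)" for i j
    by (intro has_real_derivative_vec_nth has_vector_derivative_vec_nth G)
  have "\<exists>d. ((\<lambda>y. ?A y $ k $ j) has_real_derivative d) (at x)" for k j
  proof -
    have "((\<lambda>t. (\<chi> i l. if l = k then axis j 1 $ i else G t $ i $ l) $ a $ b) has_real_derivative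
        (\<chi> i l. if l = k then 0 else G' x $ i $ l) $ a $ b) (at x)" for a b
      using dG by simp
    from det_has_real_derivative[OF this] obtain e where
      "((\<lambda>t. det (\<chi> i l. if l = k then axis j 1 $ i else G t $ i $ l)) has_real_derivative e) (at x)" by blast
    from DERIV_divide[OF this det_has_real_derivative[OF dG] d0]
    show ?thesis unfolding entry by blast
  qed
  then obtain d where d: "\<And>k j. ((\<lambda>y. ?A y $ k $ j) has_real_derivative d k j) (at x)" by metis
  define D where "D = (\<chi> k j. d k j)"
  have D: "(?A has_vector_derivative D) (at x)"
    by (rule has_vector_derivative_matrixI) (simp add: D_def d)
  have "((\<lambda>y. ?A y ** G y) has_vector_derivative ?A x ** G' x + D ** G x) (at x)"
    by (rule bounded_bilinear.has_vector_derivative[OF bounded_bilinear_matrix_matrix_mult D G])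
  then have "((\<lambda>y. mat 1) has_vector_derivative ?A x ** G' x + D ** G x) (at x)"
    by (simp add: AG)
  then have "?A x ** G' x + D ** G x = 0"
    using vector_derivative_unique_at[OF _ has_vector_derivative_const] by blast
  then have "(D ** G x) ** ?A x = - (?A x ** G' x) ** ?A x"
    by (simp add: add_eq_0_iff)
  then have "D = - (?A x ** G' x) ** ?A x"
    by (simp add: matrix_mul_assoc[symmetric] GA)
  moreover have "- (?A x ** G' x) ** ?A x = - (?A x ** G' x ** ?A x)"
    by (simp add: matrix_matrix_mult_def vec_eq_iff sum_negf)
  ultimately show ?thesis using D by simp
qed

section \<open>The transformation of solutions and its dual\<close>

text \<open>The axiom \<open>comm\<close> encodes \<open>(\<Lambda>\<^sub>i - \<Lambda>\<^sub>j) \<integral>\<^sub>x\<^sup>\<infinity> \<phi>\<^sub>i \<phi>\<^sub>j = - W(\<phi>\<^sub>i, \<phi>\<^sub>j)(x)\<close>; it is kept separate from \<open>dG\<close>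
  because it fixes the constants of integration in \<open>G\<close>.\<close>

locale double_commutation =
  fixes q :: "real \<Rightarrow> real" and \<Lambda> :: "'n::finite \<Rightarrow> real"
    and \<phi> \<phi>' :: "real \<Rightarrow> real^'n" and G A :: "real \<Rightarrow> real^'n^'n"
  assumes phi: "\<And>n. sturm q (\<lambda>x. \<Lambda> n * \<phi> x $ n) (\<lambda>x. \<phi> x $ n) (\<lambda>x. \<phi>' x $ n)"
    and dG: "\<And>x. (G has_vector_derivative - outer (\<phi> x) (\<phi> x)) (at x)"
    and dA: "\<And>x. (A has_vector_derivative outer (A x *v \<phi> x) (A x *v \<phi> x)) (at x)"
    and symG: "\<And>x y z. y \<bullet> (G x *v z) = z \<bullet> (G x *v y)"
    and GA: "\<And>x y. G x *v (A x *v y) = y"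
    and AG: "\<And>x y. A x *v (G x *v y) = y"
    and comm: "\<And>x i j. (\<Lambda> i - \<Lambda> j) * G x $ i $ j = \<phi>' x $ i * \<phi> x $ j - \<phi> x $ i * \<phi>' x $ j"
begin

definition Phi :: "real \<Rightarrow> real^'n" where "Phi x = A x *v \<phi> x"
definition kap :: "real \<Rightarrow> real" where "kap x = \<phi> x \<bullet> Phi x"
definition Phi' :: "real \<Rightarrow> real^'n" where "Phi' x = A x *v \<phi>' x + kap x *\<^sub>R Phi x"
definition kap' :: "real \<Rightarrow> real" where "kap' x = 2 * (\<phi>' x \<bullet> Phi x) + (kap x)\<^sup>2"

lemma symA: "y \<bullet> (A x *v z) = z \<bullet> (A x *v y)"
  by (metis GA inner_commute symG)

lemma d\<phi>: "(\<phi> has_vector_derivative \<phi>' x) (at x)"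
  by (rule has_vector_derivative_vecI) (rule sturm_deriv[OF phi])

lemma continuous_\<phi>: "continuous_on S \<phi>" "continuous_on S \<phi>'"
  using continuous_on_vec_lambda[of S "\<lambda>n x. \<phi> x $ n"] continuous_on_vec_lambda[of S "\<lambda>n x. \<phi>' x $ n"]
    sturm_continuous[OF phi] by simp_all

lemma dPhi: "(Phi has_vector_derivative Phi' x) (at x)"
proof -
  have "((\<lambda>x. A x *v \<phi> x) has_vector_derivative A x *v \<phi>' x + outer (A x *v \<phi> x) (A x *v \<phi> x) *v \<phi> x) (at x)"
    by (rule has_vector_derivative_matrix_vector_mult[OF dA d\<phi>])
  then show ?thesis
    by (simp add: Phi_def[abs_def] Phi'_def kap_def outer_mult_vec inner_commute)
qed

lemma dkap: "(kap has_real_derivative kap' x) (at x)"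
proof -
  have "((\<lambda>x. \<phi> x \<bullet> Phi x) has_real_derivative \<phi> x \<bullet> Phi' x + \<phi>' x \<bullet> Phi x) (at x)"
    by (rule has_real_derivative_inner[OF d\<phi> dPhi])
  moreover have "\<phi> x \<bullet> Phi' x = \<phi>' x \<bullet> Phi x + (kap x)\<^sup>2"
    by (simp add: Phi'_def inner_add_right symA[of "\<phi> x"] power2_eq_square)
       (simp add: Phi_def kap_def)
  ultimately show ?thesis by (simp add: kap_def[abs_def] kap'_def)
qed

lemma continuous_Phi: "continuous_on S Phi"
  by (rule has_vector_derivative_continuous_on_UNIV[OF dPhi])

lemma continuous_kap: "continuous_on S kap" "continuous_on S kap'"
proof -
  show "continuous_on S kap"
    using dkap DERIV_continuous_on has_field_derivative_at_within by blast
  then show "continuous_on S kap'"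
    unfolding kap'_def by (intro continuous_intros continuous_\<phi> continuous_Phi)
qed

text \<open>The axiom \<open>comm\<close> in operator form: the commutator of
  \<open>diag \<Lambda>\<close> with \<open>G x\<close> has rank at most two, being
  \<open>\<phi>'\<close> times \<open>\<phi>\<close> transposed minus \<open>\<phi>\<close> times
  \<open>\<phi>'\<close> transposed.\<close>

lemma commutator:
  "z \<bullet> (\<chi> i. \<Lambda> i * (G x *v y) $ i) - z \<bullet> (G x *v (\<chi> i. \<Lambda> i * y $ i))
    = (z \<bullet> \<phi>' x) * (\<phi> x \<bullet> y) - (z \<bullet> \<phi> x) * (\<phi>' x \<bullet> y)"
proof -
  have "z \<bullet> (\<chi> i. \<Lambda> i * (G x *v y) $ i) - z \<bullet> (G x *v (\<chi> i. \<Lambda> i * y $ i))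
     = (\<Sum>i\<in>UNIV. \<Sum>j\<in>UNIV. z $ i * y $ j * ((\<Lambda> i - \<Lambda> j) * G x $ i $ j))"
    by (simp add: inner_vec_def matrix_vector_mult_def sum_distrib_left algebra_simps flip: sum_subtractf)
  also have "\<dots> = (\<Sum>i\<in>UNIV. \<Sum>j\<in>UNIV. (z $ i * \<phi>' x $ i) * (\<phi> x $ j * y $ j) - (z $ i * \<phi> x $ i) * (\<phi>' x $ j * y $ j))"
    unfolding comm by (simp add: algebra_simps)
  also have "\<dots> = (z \<bullet> \<phi>' x) * (\<phi> x \<bullet> y) - (z \<bullet> \<phi> x) * (\<phi>' x \<bullet> y)"
    by (simp add: inner_vec_def sum_subtractf sum_product)
  finally show ?thesis .
qed

context
  fixes u u' :: "real \<Rightarrow> real" and c :: "real \<Rightarrow> real^'n"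
  assumes dc: "\<And>x. (c has_vector_derivative (- u x) *\<^sub>R \<phi> x) (at x)"
begin

lemma Phi_inner: "Phi x \<bullet> y = \<phi> x \<bullet> (A x *v y)"
  using symA[of y x "\<phi> x"] by (simp add: Phi_def inner_commute)

text \<open>With \<open>v = u - Phi \<bullet> c\<close> this has the shape of \<open>dc\<close>
  again: \<open>A c\<close> is to \<open>v\<close> and \<open>Phi\<close> what \<open>c\<close> is
  to \<open>u\<close> and \<open>\<phi>\<close>.\<close>

lemma dAc: "((\<lambda>x. A x *v c x) has_vector_derivative (- (u x - Phi x \<bullet> c x)) *\<^sub>R Phi x) (at x)"
proof -
  have "((\<lambda>x. A x *v c x) has_vector_derivative A x *v ((- u x) *\<^sub>R \<phi> x) + outer (A x *v \<phi> x) (A x *v \<phi> x) *v c x) (at x)"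
    by (rule has_vector_derivative_matrix_vector_mult[OF dA dc])
  moreover have "A x *v ((- u x) *\<^sub>R \<phi> x) + outer (A x *v \<phi> x) (A x *v \<phi> x) *v c x
      = (- (u x - Phi x \<bullet> c x)) *\<^sub>R Phi x"
    by (simp add: outer_mult_vec Phi_def matrix_vector_mult_scaleR algebra_simps del: scaleR_minus_left)
       (simp add: algebra_simps)
  ultimately show ?thesis by simp
qed

text \<open>Both halves of the product rule are multiples of \<open>p = Phi x \<bullet> c x\<close>.
  With \<open>v = u - p\<close> their sum is \<open>- (v + u) * p\<close>, and
  \<open>p = u - v\<close>.\<close>

lemma d_energy:
  "((\<lambda>x. c x \<bullet> (A x *v c x)) has_real_derivative (u x - Phi x \<bullet> c x)\<^sup>2 - (u x)\<^sup>2) (at x)"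
proof -
  have "((\<lambda>x. c x \<bullet> (A x *v c x)) has_real_derivative
     c x \<bullet> ((- (u x - Phi x \<bullet> c x)) *\<^sub>R Phi x) + ((- u x) *\<^sub>R \<phi> x) \<bullet> (A x *v c x)) (at x)"
    by (rule has_real_derivative_inner[OF dc dAc])
  moreover have "c x \<bullet> ((- (u x - Phi x \<bullet> c x)) *\<^sub>R Phi x) + ((- u x) *\<^sub>R \<phi> x) \<bullet> (A x *v c x)
     = (u x - Phi x \<bullet> c x)\<^sup>2 - (u x)\<^sup>2"
    by (simp add: Phi_inner[symmetric] inner_commute[of "c x"] power2_eq_square algebra_simps)
  ultimately show ?thesis by simp
qed

text \<open>After differentiation the one term that is not visibly a multiple of \<open>u\<close>,
  \<open>c\<close> or their derivatives is the sum of
  \<open>\<Lambda> n * \<phi> n * (A c) n\<close>; the commutator identity exchanges it for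
  \<open>Phi \<bullet> diag \<Lambda> c\<close>, which the second hypothesis on \<open>c\<close>
  evaluates. The vector \<open>d\<close> collects constants of integration: where
  \<open>\<Lambda> n\<close> differs from \<open>lam\<close> it could be absorbed by shifting
  \<open>c\<close>, where they agree it cannot.\<close>

lemma transform:
  assumes u: "sturm q (\<lambda>x. lam * u x) u u'"
    and c: "\<And>n x. (\<Lambda> n - lam) * c x $ n = \<phi>' x $ n * u x - \<phi> x $ n * u' x + d $ n"
  shows "sturm (\<lambda>x. q x + 2 * kap' x) (\<lambda>x. lam * (u x - Phi x \<bullet> c x) - Phi x \<bullet> d)
     (\<lambda>x. u x - Phi x \<bullet> c x)
     (\<lambda>x. u' x + kap x * (u x - Phi x \<bullet> c x) - \<phi>' x \<bullet> (A x *v c x))"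
proof -
  define h where "h = (\<lambda>x. u x - Phi x \<bullet> c x)"
  define h' where "h' = (\<lambda>x. u' x + kap x * h x - \<phi>' x \<bullet> (A x *v c x))"
  have dh: "(h has_real_derivative h' x) (at x)" for x
  proof -
    have "(h has_real_derivative u' x - (Phi x \<bullet> ((- u x) *\<^sub>R \<phi> x) + Phi' x \<bullet> c x)) (at x)"
      unfolding h_def by (intro DERIV_diff sturm_deriv[OF u] has_real_derivative_inner dPhi dc)
    moreover have "Phi' x \<bullet> c x = \<phi>' x \<bullet> (A x *v c x) + kap x * (Phi x \<bullet> c x)"
      using symA[of "c x" x "\<phi>' x"] by (simp add: Phi'_def inner_add_left inner_add_right inner_commute)
    moreover have "Phi x \<bullet> ((- u x) *\<^sub>R \<phi> x) = - (u x * kap x)"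
      by (simp add: kap_def inner_commute)
    ultimately have "u' x - (Phi x \<bullet> ((- u x) *\<^sub>R \<phi> x) + Phi' x \<bullet> c x) = h' x"
      by (simp only: h'_def h_def) (simp add: algebra_simps)
    with \<open>(h has_real_derivative _) (at x)\<close> show ?thesis by simp
  qed
  have ch: "continuous_on S h" for S
    using dh DERIV_continuous_on has_field_derivative_at_within by blast
  have cAc: "continuous_on S (\<lambda>x. A x *v c x)" for S
    by (rule has_vector_derivative_continuous_on_UNIV[OF dAc])
  have ch': "continuous_on S h'" for S
    unfolding h'_def
    by (intro continuous_intros sturm_continuous[OF u] continuous_kap ch continuous_\<phi> cAc)
  have dAc': "((\<lambda>x. (A x *v c x) $ n) has_real_derivative (- h x) * Phi x $ n) (at x)" for n x
    using has_real_derivative_vec_nth[OF dAc, of n x] by (simp add: h_def)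
  have cPn: "continuous_on UNIV (\<lambda>x. (- h x) * Phi x $ n)" for n
    by (intro continuous_intros ch continuous_Phi)
  have "indef (\<lambda>x. (q x * u x - lam * u x) + (kap' x * h x + kap x * h' x)
     - (\<Sum>n\<in>UNIV. (q x * \<phi> x $ n - \<Lambda> n * \<phi> x $ n) * (A x *v c x) $ n + \<phi>' x $ n * ((- h x) * Phi x $ n)))
     (\<lambda>x. u' x + kap x * h x - (\<Sum>n\<in>UNIV. \<phi>' x $ n * (A x *v c x) $ n))"
    by (intro indef_diff indef_add indef_sum indef_mult sturm_indef[OF u] sturm_indef[OF phi] dAc' cPn
         indef_mult[OF indef_C1[OF dkap continuous_kap(2)]] dh ch')
  then have "indef (\<lambda>x. (q x + 2 * kap' x) * h x - (lam * h x - Phi x \<bullet> d)) h'"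
  proof (rule indef_cong)
    fix x
    show "u' x + kap x * h x - (\<Sum>n\<in>UNIV. \<phi>' x $ n * (A x *v c x) $ n) = h' x"
      by (simp add: h'_def inner_vec_def)
    define P where "P = \<phi> x \<bullet> (A x *v c x)"
    define X where "X = \<phi>' x \<bullet> (A x *v c x)"
    define Y where "Y = \<phi>' x \<bullet> Phi x"
    define Z where "Z = (\<Sum>n\<in>UNIV. \<Lambda> n * \<phi> x $ n * (A x *v c x) $ n)"
    have hP: "h x = u x - P" by (simp add: h_def P_def Phi_inner)
    have kk: "kap' x = 2 * Y + (kap x)\<^sup>2" by (simp add: kap'_def Y_def)
    have h'x: "h' x = u' x + kap x * h x - X" by (simp add: h'_def X_def)
    have s: "(\<Sum>n\<in>UNIV. (q x * \<phi> x $ n - \<Lambda> n * \<phi> x $ n) * (A x *v c x) $ n + \<phi>' x $ n * ((- h x) * Phi x $ n))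
      = q x * P - Z - h x * Y"
      by (simp add: P_def Y_def Z_def inner_vec_def sum.distrib sum_subtractf sum_distrib_left algebra_simps sum_negf)
    \<comment> \<open>The commutator is tested with \<open>Phi\<close> and \<open>A c\<close>:
      \<open>G\<close> cancels \<open>A\<close> in the first term, and in the second
      \<open>G\<close> turns \<open>Phi\<close> back into \<open>\<phi>\<close>, which produces
      \<open>Z\<close>.\<close>
    have "Phi x \<bullet> (\<chi> i. \<Lambda> i * c x $ i) - Phi x \<bullet> (G x *v (\<chi> i. \<Lambda> i * (A x *v c x) $ i)) = Y * P - kap x * X"
      using commutator[of "Phi x" x "A x *v c x"]
      by (simp add: GA Y_def P_def X_def kap_def inner_commute)
    moreover have "Phi x \<bullet> (G x *v (\<chi> i. \<Lambda> i * (A x *v c x) $ i)) = Z"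
      by (simp add: Phi_inner AG Z_def) (simp add: inner_vec_def algebra_simps)
    moreover have "Phi x \<bullet> (\<chi> i. \<Lambda> i * c x $ i) = lam * P + Y * u x - kap x * u' x + Phi x \<bullet> d"
    proof -
      have "\<Lambda> n * c x $ n = lam * c x $ n + (\<phi>' x $ n * u x - \<phi> x $ n * u' x + d $ n)" for n
        using c[of n x] by (simp add: algebra_simps)
      then have "(\<chi> i. \<Lambda> i * c x $ i) = lam *\<^sub>R c x + (u x *\<^sub>R \<phi>' x - u' x *\<^sub>R \<phi> x + d)"
        by (simp add: vec_eq_iff)
      then show ?thesis
        by (simp add: inner_add_right inner_diff_right P_def Y_def kap_def Phi_inner[symmetric] inner_commute)
    qed
    ultimately have Z: "lam * P + Y * u x - kap x * u' x + Phi x \<bullet> d - Z = Y * P - kap x * X" by simp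
    show "(q x * u x - lam * u x) + (kap' x * h x + kap x * h' x)
     - (\<Sum>n\<in>UNIV. (q x * \<phi> x $ n - \<Lambda> n * \<phi> x $ n) * (A x *v c x) $ n + \<phi>' x $ n * ((- h x) * Phi x $ n))
      = (q x + 2 * kap' x) * h x - (lam * h x - Phi x \<bullet> d)"
      unfolding s unfolding kk h'x hP using Z by algebra
  qed
  then show ?thesis using dh unfolding sturm_def h'_def h_def by blast
qed

end

text \<open>A component of \<open>Phi\<close> is the transform of \<open>u = 0\<close> with the
  constant vector \<open>c = - axis n 1\<close>. The relation required of \<open>c\<close> holds
  with \<open>d = 0\<close>, because its only nonzero entry meets the factor
  \<open>\<Lambda> n - \<Lambda> n\<close>.\<close>

lemma Phi_sturm: "sturm (\<lambda>x. q x + 2 * kap' x) (\<lambda>x. \<Lambda> n * Phi x $ n) (\<lambda>x. Phi x $ n) (\<lambda>x. Phi' x $ n)"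
proof -
  have "sturm (\<lambda>x. q x + 2 * kap' x) (\<lambda>x. \<Lambda> n * (0 - Phi x \<bullet> (- axis n 1)) - Phi x \<bullet> 0)
     (\<lambda>x. 0 - Phi x \<bullet> (- axis n 1))
     (\<lambda>x. 0 + kap x * (0 - Phi x \<bullet> (- axis n 1)) - \<phi>' x \<bullet> (A x *v (- axis n 1)))"
  proof (rule transform)
    show "((\<lambda>x. - axis n 1) has_vector_derivative (- 0) *\<^sub>R \<phi> x) (at x)" for x by simp
    show "sturm q (\<lambda>x. \<Lambda> n * 0) (\<lambda>x. 0) (\<lambda>x. 0)" by (simp add: sturm_def indef_const)
    show "(\<Lambda> m - \<Lambda> n) * (- axis n 1 :: real^'n) $ m = \<phi>' x $ m * 0 - \<phi> x $ m * 0 + (0 :: real^'n) $ m" for m x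
      by (simp add: axis_def)
  qed
  moreover have "Phi' x $ n = 0 + kap x * (0 - Phi x \<bullet> (- axis n 1)) - \<phi>' x \<bullet> (A x *v (- axis n 1))" for x
  proof -
    have "(A x *v \<phi>' x) $ n = axis n 1 \<bullet> (A x *v \<phi>' x)" by (simp add: inner_axis')
    also have "\<dots> = \<phi>' x \<bullet> (A x *v axis n 1)" by (rule symA)
    finally show ?thesis
      by (simp add: Phi'_def inner_axis bounded_bilinear.minus_right[OF bounded_bilinear_matrix_vector_mult])
  qed
  ultimately show ?thesis by (simp add: inner_axis)
qed

text \<open>The data \<open>(\<Phi>, - A, - G)\<close> satisfy the same axioms over the new potential, so that
  the same formula also describes the inverse transformation.\<close>

lemma dual: "double_commutation (\<lambda>x. q x + 2 * kap' x) \<Lambda> Phi Phi' (\<lambda>x. - A x) (\<lambda>x. - G x)"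
proof
  note neg = bounded_bilinear.minus_left[OF bounded_bilinear_matrix_vector_mult]
    bounded_bilinear.minus_right[OF bounded_bilinear_matrix_vector_mult]
  fix x y z i j
  show "sturm (\<lambda>x. q x + 2 * kap' x) (\<lambda>x. \<Lambda> i * Phi x $ i) (\<lambda>x. Phi x $ i) (\<lambda>x. Phi' x $ i)"
    by (rule Phi_sturm)
  show "((\<lambda>x. - A x) has_vector_derivative - outer (Phi x) (Phi x)) (at x)"
    using has_vector_derivative_minus[OF dA[of x]] by (simp add: Phi_def)
  have "- G x *v Phi x = - \<phi> x" by (simp add: Phi_def GA neg)
  moreover have "outer (- \<phi> x) (- \<phi> x) = outer (\<phi> x) (\<phi> x)" by (simp add: outer_def)
  ultimately show "((\<lambda>x. - G x) has_vector_derivative outer (- G x *v Phi x) (- G x *v Phi x)) (at x)"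
    using has_vector_derivative_minus[OF dG[of x]] by simp
  show "y \<bullet> (- A x *v z) = z \<bullet> (- A x *v y)" using symA by (simp add: neg)
  show "- A x *v (- G x *v y) = y" by (simp add: AG neg)
  show "- G x *v (- A x *v y) = y" by (simp add: GA neg)
  \<comment> \<open>\<open>a k\<close> is the k-th column of \<open>A x\<close>. Testing the
    commutator with two columns multiplies it by \<open>A\<close> on both sides, which turns the
    commutator of \<open>\<Lambda>\<close> and \<open>G\<close> into that of \<open>A\<close> and
    \<open>\<Lambda>\<close>.\<close>
  define a where "a k = A x *v axis k 1" for k
  have an: "a k $ l = A x $ l $ k" for k l by (simp add: a_def matrix_vector_mult_basis column_def)
  have sA: "A x $ l $ k = A x $ k $ l" for k l
    using symA[of "axis l 1" x "axis k 1"] an by (simp add: inner_axis' a_def)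
  have aP: "a k \<bullet> \<phi> x = Phi x $ k" "a k \<bullet> \<phi>' x = (A x *v \<phi>' x) $ k" for k
    using symA[of "\<phi> x" x "axis k 1"] symA[of "\<phi>' x" x "axis k 1"]
    by (simp_all add: a_def inner_axis' inner_commute[of "A x *v axis k 1"] Phi_def)
  have ax: "(\<chi> k. \<Lambda> k * (axis j 1 :: real^'n) $ k) = \<Lambda> j *\<^sub>R axis j 1"
    by (simp add: vec_eq_iff axis_def)
  have 1: "a i \<bullet> (\<chi> k. \<Lambda> k * (G x *v a j) $ k) = \<Lambda> j * A x $ i $ j"
    by (simp add: a_def GA ax inner_axis) (simp add: a_def[symmetric] an sA)
  have "a i \<bullet> (G x *v (\<chi> k. \<Lambda> k * a j $ k)) = (\<chi> k. \<Lambda> k * a j $ k) \<bullet> (G x *v a i)" by (rule symG)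
  also have "\<dots> = \<Lambda> i * A x $ i $ j"
    by (simp add: a_def[of i] GA inner_axis an)
  finally have 2: "a i \<bullet> (G x *v (\<chi> k. \<Lambda> k * a j $ k)) = \<Lambda> i * A x $ i $ j" .
  have "(\<Lambda> j - \<Lambda> i) * A x $ i $ j = (A x *v \<phi>' x) $ i * Phi x $ j - Phi x $ i * (A x *v \<phi>' x) $ j"
    using commutator[of "a i" x "a j"] 1 2 aP by (simp add: algebra_simps inner_commute)
  \<comment> \<open>The parts \<open>kap x *\<^sub>R Phi x\<close> of \<open>Phi'\<close> cancel in
    the antisymmetric expression.\<close>
  then show "(\<Lambda> i - \<Lambda> j) * (- A x) $ i $ j = Phi' x $ i * Phi x $ j - Phi x $ i * Phi' x $ j"
    by (simp add: Phi'_def algebra_simps)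
qed

text \<open>Since \<open>G\<close> undoes \<open>A\<close>, passing to the dual replaces
  \<open>kap\<close> by \<open>- kap\<close>, so the two corrections of the potential
  cancel.\<close>

lemma dual_Phi: "double_commutation.Phi Phi (\<lambda>x. - G x) x = - \<phi> x"
  and dual_potential: "q x + 2 * kap' x + 2 * double_commutation.kap' Phi Phi' (\<lambda>x. - G x) x = q x"
proof -
  interpret D: double_commutation "\<lambda>x. q x + 2 * kap' x" \<Lambda> Phi Phi' "\<lambda>x. - A x" "\<lambda>x. - G x"
    by (rule dual)
  show P: "D.Phi x = - \<phi> x"
    by (simp add: D.Phi_def Phi_def GA bounded_bilinear.minus_left[OF bounded_bilinear_matrix_vector_mult])
  have "Phi' x \<bullet> \<phi> x = \<phi>' x \<bullet> Phi x + (kap x)\<^sup>2"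
    using symA[of "\<phi> x" x "\<phi>' x"]
    by (simp add: Phi'_def inner_add_left inner_add_right inner_commute power2_eq_square kap_def)
       (simp add: Phi_def inner_commute)
  then have "D.kap' x = - kap' x"
    unfolding D.kap'_def D.kap_def P kap'_def by (simp add: kap_def inner_commute)
  then show "q x + 2 * kap' x + 2 * D.kap' x = q x" by simp
qed

end

section \<open>Gram matrices of eigenfunctions\<close>

lemma cumint_cmult: "cumint (\<lambda>s. k * g s) x = k * cumint g x"
  unfolding cumint_def by simp

text \<open>A contraction argument: on a short interval \<open>u'\<close> is bounded by a quarter of
  the maximum of \<open>\<bar>u\<bar>\<close>, and integrating over a length at most 1 bounds that
  maximum by a quarter of itself.\<close>

lemma sturm_zero_locally:
  assumes q: "locally_integrable q" and u: "sturm q (\<lambda>x. lam * u x) u u'"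
    and z: "u t = 0" "u' t = 0"
  shows "\<exists>e>0. \<forall>s. \<bar>s - t\<bar> \<le> e \<longrightarrow> u s = 0"
proof -
  have abs: "(\<lambda>s. q s - lam) absolutely_integrable_on {a..b}" for a b
  proof (rule set_integral_diff(1))
    show "q absolutely_integrable_on {a..b}"
      using locally_integrable_mult_continuous[OF q, of "\<lambda>_. 1" a b] by simp
  qed (auto intro: absolutely_integrable_continuous_real)
  then have nint: "(\<lambda>s. \<bar>q s - lam\<bar>) integrable_on {a..b}" for a b
    by (metis (no_types, lifting) absolutely_integrable_on_def ext real_norm_def)
  define N where "N x = integral {t-1..x} (\<lambda>s. \<bar>q s - lam\<bar>)" for x
  have "continuous_on {t-1..t+1} N"
    unfolding N_def by (rule indefinite_integral_continuous_1[OF nint])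
  then have "continuous (at t) N" by (rule continuous_on_interior) simp
  \<comment> \<open>The value 1/4 bounds the integral of \<open>\<bar>q - lam\<bar>\<close> on
    either side of \<open>t\<close>; with radius at most 1, any number below 1 would serve.\<close>
  then obtain d where d: "d > 0" "\<And>s. \<bar>s - t\<bar> < d \<Longrightarrow> \<bar>N s - N t\<bar> < 1/4"
    unfolding continuous_at_eps_delta by (metis dist_real_def zero_less_divide_1_iff zero_less_numeral)
  define e where "e = min (d / 2) 1"
  have e: "0 < e" "e < d" "e \<le> 1" using d(1) by (auto simp: e_def)
  have cu: "continuous_on S u" for S by (rule sturm_continuous(1)[OF u])
  have "\<exists>m\<in>{t-e..t+e}. \<forall>s\<in>{t-e..t+e}. \<bar>u s\<bar> \<le> \<bar>u m\<bar>"
    using e by (intro continuous_attains_sup continuous_intros cu) auto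
  then obtain m where m: "m \<in> {t-e..t+e}" "\<And>s. s \<in> {t-e..t+e} \<Longrightarrow> \<bar>u s\<bar> \<le> \<bar>u m\<bar>" by blast
  have step: "\<bar>u' b - u' a\<bar> \<le> \<bar>u m\<bar> * (N b - N a)" if ab: "t - e \<le> a" "a \<le> b" "b \<le> t + e" for a b
  proof -
    have "u' b - u' a = integral {a..b} (\<lambda>s. q s * u s - lam * u s)"
      using indef_int[OF sturm_indef[OF u] ab(2)] by (simp add: integral_unique)
    also have "norm \<dots> \<le> integral {a..b} (\<lambda>s. \<bar>u m\<bar> * \<bar>q s - lam\<bar>)"
    proof (rule integral_norm_bound_integral)
      show "(\<lambda>s. q s * u s - lam * u s) integrable_on {a..b}"
        using indef_int[OF sturm_indef[OF u] ab(2)] by blast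
      show "(\<lambda>s. \<bar>u m\<bar> * \<bar>q s - lam\<bar>) integrable_on {a..b}"
        using nint by (intro integrable_on_mult_right)
      fix s assume "s \<in> {a..b}"
      then have "\<bar>u s\<bar> \<le> \<bar>u m\<bar>" using m(2) ab by auto
      then show "norm (q s * u s - lam * u s) \<le> \<bar>u m\<bar> * \<bar>q s - lam\<bar>"
        by (simp add: left_diff_distrib[symmetric] abs_mult mult.commute mult_right_mono)
    qed
    also have "integral {a..b} (\<lambda>s. \<bar>q s - lam\<bar>) = N b - N a"
      using Henstock_Kurzweil_Integration.integral_combine[of "t-1" a b "\<lambda>s. \<bar>q s - lam\<bar>"] nint ab e
      by (simp add: N_def)
    then have "integral {a..b} (\<lambda>s. \<bar>u m\<bar> * \<bar>q s - lam\<bar>) = \<bar>u m\<bar> * (N b - N a)" by simp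
    finally show ?thesis by simp
  qed
  have u'b: "\<bar>u' s\<bar> \<le> \<bar>u m\<bar> / 4" if s: "s \<in> {t-e..t+e}" for s
  proof -
    have Ns: "\<bar>N s - N t\<bar> \<le> 1/4" using d(2)[of s] s e by fastforce
    have "\<bar>u' s\<bar> \<le> \<bar>u m\<bar> * \<bar>N s - N t\<bar>"
    proof (cases "t \<le> s")
      case True
      have "\<bar>u' s\<bar> \<le> \<bar>u m\<bar> * (N s - N t)" using step[of t s] True s e z by auto
      also have "\<dots> \<le> \<bar>u m\<bar> * \<bar>N s - N t\<bar>" by (intro mult_left_mono) auto
      finally show ?thesis .
    next
      case False
      have "\<bar>u' s\<bar> \<le> \<bar>u m\<bar> * (N t - N s)" using step[of s t] False s e z by auto
      also have "\<dots> \<le> \<bar>u m\<bar> * \<bar>N s - N t\<bar>" by (intro mult_left_mono) auto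
      finally show ?thesis .
    qed
    also have "\<dots> \<le> \<bar>u m\<bar> * (1/4)" using Ns by (intro mult_left_mono) auto
    finally show ?thesis by simp
  qed
  have "norm (u m - u t) \<le> \<bar>u m\<bar> / 4 * norm (m - t)"
    using u'b m(1) e
    by (intro field_differentiable_bound[of "{t-e..t+e}" u u'])
       (auto intro: has_field_derivative_at_within sturm_deriv[OF u])
  also have "\<dots> \<le> \<bar>u m\<bar> / 4 * 1" using m(1) e by (intro mult_left_mono) auto
  finally have "u m = 0" using z by simp
  then have "u s = 0" if "\<bar>s - t\<bar> \<le> e" for s
    using m(2)[of s] that by (auto simp: abs_le_iff)
  then show ?thesis using e(1) by blast
qed

text \<open>Connectedness of the line: the common zeros of \<open>u\<close> and \<open>u'\<close>
  form a closed set, which the local statement shows to be open.\<close>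

lemma sturm_zero:
  assumes q: "locally_integrable q" and u: "sturm q (\<lambda>x. lam * u x) u u'"
    and z: "u t = 0" "u' t = 0"
  shows "u x = 0"
proof -
  define Z where "Z = {s. u s = 0} \<inter> {s. u' s = 0}"
  have "closed Z" unfolding Z_def
    by (intro closed_Int closed_Collect_eq sturm_continuous[OF u] continuous_on_const)
  moreover have "open Z"
    unfolding open_dist
  proof
    fix s assume "s \<in> Z"
    then obtain e where e: "e > 0" "\<And>r. \<bar>r - s\<bar> \<le> e \<Longrightarrow> u r = 0"
      using sturm_zero_locally[OF q u, of s] by (auto simp: Z_def)
    have "u' r = 0" if r: "\<bar>r - s\<bar> < e" for r
    proof -
      have "((\<lambda>_. 0) has_real_derivative 0) (at r)" by simp
      then have "(u has_real_derivative 0) (at r)"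
        by (rule has_field_derivative_transform_within_open[of _ _ _ "ball s e"])
           (use e(2) r in \<open>auto simp: dist_real_def abs_minus_commute\<close>)
      then show ?thesis using sturm_deriv[OF u] DERIV_unique by blast
    qed
    then show "\<exists>e>0. \<forall>r. dist r s < e \<longrightarrow> r \<in> Z"
      using e by (intro exI[of _ e]) (auto simp: Z_def dist_real_def)
  qed
  moreover have "t \<in> Z" using z by (simp add: Z_def)
  ultimately have "Z = UNIV" using clopen[of Z] by auto
  then show ?thesis by (auto simp: Z_def)
qed

text \<open>Semiboundedness puts both ends in the limit point case, so every eigenvalue is simple.\<close>

lemma L2_solution_unique:
  assumes q: "locally_integrable q" "semibounded_below q"
    and f: "sturm q (\<lambda>x. lam * f x) f f'" "integrable lborel (\<lambda>x. (f x)\<^sup>2)" "f x0 \<noteq> 0"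
    and g: "sturm q (\<lambda>x. lam * g x) g g'" "integrable lborel (\<lambda>x. (g x)\<^sup>2)"
  shows "\<exists>a. \<forall>x. g x = a * f x"
proof -
  have i: "integrable lborel (\<lambda>x. (lam * f x)\<^sup>2)" "integrable lborel (\<lambda>x. (lam * g x)\<^sup>2)"
    using f(2) g(2) by (simp_all add: power_mult_distrib)
  have c: "continuous_on UNIV (\<lambda>x. lam * f x)" "continuous_on UNIV (\<lambda>x. lam * g x)"
    using sturm_continuous(1)[OF f(1)] sturm_continuous(1)[OF g(1)] by (auto intro: continuous_intros)
  have "f x0 * g' x0 - f' x0 * g x0 = cumint (\<lambda>x. lam * f x * g x - f x * (lam * g x)) x0"
    by (rule wronskian_eq_cumint(1)[OF q f(1) g(1) c f(2) i(1) g(2) i(2)])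
  also have "(\<lambda>x. lam * f x * g x - f x * (lam * g x)) = (\<lambda>x. 0 * 0)" by auto
  finally have W: "f x0 * g' x0 = f' x0 * g x0" unfolding cumint_cmult by simp
  \<comment> \<open>This factor matches the values at \<open>x0\<close>; the vanishing Wronskian
    then matches the derivatives.\<close>
  define a where "a = g x0 / f x0"
  have "sturm q (\<lambda>x. 1 * (lam * g x) + (- a) * (lam * f x)) (\<lambda>x. 1 * g x + (- a) * f x) (\<lambda>x. 1 * g' x + (- a) * f' x)"
    by (rule sturm_combination[OF g(1) f(1)])
  then have "sturm q (\<lambda>x. lam * (g x - a * f x)) (\<lambda>x. g x - a * f x) (\<lambda>x. g' x - a * f' x)"
    by (simp add: algebra_simps)
  moreover have "g x0 - a * f x0 = 0" "g' x0 - a * f' x0 = 0"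
    using f(3) W by (simp_all add: a_def field_simps)
  ultimately have "g x - a * f x = 0" for x
    using sturm_zero[OF q(1), of lam "\<lambda>x. g x - a * f x"] by blast
  then show ?thesis by (intro exI[of _ a]) simp
qed

lemma antitone_limit_ge:
  fixes f :: "real \<Rightarrow> real"
  assumes d: "\<And>x. (f has_real_derivative f' x) (at x)" "\<And>x. f' x \<le> 0"
  shows "(f \<longlongrightarrow> l) at_top \<Longrightarrow> l \<le> f x" and "(f \<longlongrightarrow> l) at_bot \<Longrightarrow> f x \<le> l"
    and "x \<le> y \<Longrightarrow> f y \<le> f x"
proof -
  have mono: "f y \<le> f x" if "x \<le> y" for x y
    using DERIV_nonpos_imp_nonincreasing[OF that] d by blast
  then show "x \<le> y \<Longrightarrow> f y \<le> f x" .
  show "l \<le> f x" if "(f \<longlongrightarrow> l) at_top"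
    by (rule tendsto_upperbound[OF that])
       (use mono in \<open>auto intro: eventually_mono[OF eventually_ge_at_top[of x]]\<close>)
  show "f x \<le> l" if "(f \<longlongrightarrow> l) at_bot"
    by (rule tendsto_lowerbound[OF that])
       (use mono in \<open>auto intro: eventually_mono[OF eventually_le_at_bot[of x]]\<close>)
qed

lemma antiderivative_exists:
  fixes f :: "real \<Rightarrow> real"
  assumes "continuous_on UNIV f"
  shows "\<exists>F. \<forall>x. (F has_real_derivative f x) (at x)"
proof -
  have "\<exists>F. \<forall>x. -\<infinity> < ereal x \<longrightarrow> ereal x < \<infinity> \<longrightarrow> (F has_vector_derivative f x) (at x)"
    by (rule einterval_antiderivative) (use assms in \<open>auto simp: continuous_on_eq_continuous_at\<close>)
  then show ?thesis by (simp add: has_real_derivative_iff_has_vector_derivative)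
qed

lemma integral_of_derivative:
  fixes F f :: "real \<Rightarrow> real"
  assumes "\<And>x. (F has_real_derivative f x) (at x)" "a \<le> b"
  shows "(f has_integral F b - F a) {a..b}"
  by (rule fundamental_theorem_of_calculus[OF assms(2)])
     (metis assms(1) has_field_derivative_at_within has_real_derivative_iff_has_vector_derivative)

section \<open>The matrix \<open>G\<close> of an orthonormal family: monotonicity, invertibility,
  determinant\<close>

locale orthonormal_eigenfunctions =
  fixes q :: "real \<Rightarrow> real" and \<Lambda> :: "'n::finite \<Rightarrow> real" and phi phi' :: "'n \<Rightarrow> real \<Rightarrow> real"
  assumes lq: "locally_integrable q" and sb: "semibounded_below q"
    and eig: "\<And>n. sturm q (\<lambda>x. \<Lambda> n * phi n x) (phi n) (phi' n)"
    and L2: "\<And>n. integrable lborel (\<lambda>x. (phi n x)\<^sup>2)"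
    and orth: "\<And>n m. (LINT x|lborel. phi n x * phi m x) = (if n = m then 1 else 0)"
begin

definition \<phi> :: "real \<Rightarrow> real^'n" where "\<phi> x = (\<chi> n. phi n x)"
definition \<phi>' :: "real \<Rightarrow> real^'n" where "\<phi>' x = (\<chi> n. phi' n x)"
definition G :: "real \<Rightarrow> real^'n^'n" where "G x = mat 1 - Gminus phi x"
definition A :: "real \<Rightarrow> real^'n^'n" where "A x = matrix_inv (G x)"

lemma \<phi>_nth [simp]: "\<phi> x $ n = phi n x" "\<phi>' x $ n = phi' n x"
  by (simp_all add: \<phi>_def \<phi>'_def)

lemma cphi: "continuous_on S (phi n)" "continuous_on S (phi' n)"
  by (rule sturm_continuous[OF eig])+

lemma c\<phi>: "continuous_on S \<phi>" "continuous_on S \<phi>'"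
  unfolding \<phi>_def \<phi>'_def by (intro continuous_intros cphi)+

lemma d\<phi>: "(\<phi> has_vector_derivative \<phi>' x) (at x)"
  by (rule has_vector_derivative_vecI) (simp add: sturm_deriv[OF eig])

lemma phi_mult_integrable: "integrable lborel (\<lambda>x. phi n x * phi m x)"
  by (intro integrable_mult_of_squares cphi L2)

lemma phi_nonzero: "\<exists>x. phi n x \<noteq> 0"
proof (rule ccontr)
  assume "\<not> ?thesis"
  then have "(LINT x|lborel. phi n x * phi n x) = 0" by simp
  then show False using orth[of n n] by simp
qed

text \<open>Simplicity makes two eigenfunctions for the same eigenvalue proportional with a nonzero
  factor, which orthonormality excludes for different indices.\<close>

lemma inj_eig: "\<Lambda> i = \<Lambda> j \<longleftrightarrow> i = j"
proof
  assume "\<Lambda> i = \<Lambda> j"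
  obtain x where x: "phi i x \<noteq> 0" using phi_nonzero by blast
  obtain a where a: "\<And>x. phi j x = a * phi i x"
    using L2_solution_unique[OF lq sb eig L2 x, of "phi j" "phi' j"] eig[of j] L2[of j] \<open>\<Lambda> i = \<Lambda> j\<close> by metis
  have "a \<noteq> 0" using phi_nonzero[of j] a by auto
  have "(LINT x|lborel. phi i x * phi j x) = a * (LINT x|lborel. phi i x * phi i x)"
    by (simp add: a mult.left_commute)
  with orth \<open>a \<noteq> 0\<close> show "i = j" by (metis mult_cancel_left1 zero_neq_one)
qed simp

lemma G_nth: "G x $ i $ j = (if i = j then 1 else 0) - cumint (\<lambda>s. phi i s * phi j s) x"
  by (simp add: G_def Gminus_def cumint_def mat_def)

lemma dG: "(G has_vector_derivative - outer (\<phi> x) (\<phi> x)) (at x)"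
proof (rule has_vector_derivative_matrixI)
  fix i j
  have "((\<lambda>t. (if i = j then 1 else 0) - cumint (\<lambda>s. phi i s * phi j s) t) has_real_derivative 0 - phi i x * phi j x) (at x)"
    by (intro DERIV_diff DERIV_const cumint_deriv continuous_intros cphi phi_mult_integrable)
  then show "((\<lambda>t. G t $ i $ j) has_real_derivative (- outer (\<phi> x) (\<phi> x)) $ i $ j) (at x)"
    by (simp add: G_nth outer_def)
qed

lemma G_sym: "G x $ i $ j = G x $ j $ i"
  by (simp add: G_nth mult.commute)

lemma symG: "y \<bullet> (G x *v z) = z \<bullet> (G x *v y)"
proof -
  have "y \<bullet> (G x *v z) = (\<Sum>i\<in>UNIV. \<Sum>j\<in>UNIV. y $ i * (G x $ i $ j * z $ j))"
    by (simp add: inner_vec_def matrix_vector_mult_def sum_distrib_left)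
  also have "\<dots> = (\<Sum>j\<in>UNIV. \<Sum>i\<in>UNIV. y $ i * (G x $ i $ j * z $ j))" by (rule sum.swap)
  also have "\<dots> = z \<bullet> (G x *v y)"
    by (simp add: inner_vec_def matrix_vector_mult_def sum_distrib_left G_sym mult_ac)
  finally show ?thesis .
qed

lemma G_at_bot: "((\<lambda>x. G x $ i $ j) \<longlongrightarrow> mat 1 $ i $ j) at_bot"
proof -
  have "((\<lambda>x. (if i = j then 1 else 0) - cumint (\<lambda>s. phi i s * phi j s) x) \<longlongrightarrow> (if i = j then 1 else 0) - 0) at_bot"
    by (intro tendsto_diff tendsto_const cumint_at_bot phi_mult_integrable)
  then show ?thesis by (simp add: G_nth mat_def)
qed

lemma G_at_top: "((\<lambda>x. G x $ i $ j) \<longlongrightarrow> 0) at_top"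
proof -
  have "((\<lambda>x. (if i = j then 1 else 0) - cumint (\<lambda>s. phi i s * phi j s) x) \<longlongrightarrow> (if i = j then 1 else 0) - (LINT x|lborel. phi i x * phi j x)) at_top"
    by (intro tendsto_diff tendsto_const cumint_at_top phi_mult_integrable)
  then show ?thesis by (simp add: G_nth orth)
qed

text \<open>Lagrange's identity integrated from -infinity. The identity matrix in \<open>G\<close>
  affects only the diagonal, where the factor \<open>\<Lambda> i - \<Lambda> j\<close> is
  zero.\<close>

lemma comm: "(\<Lambda> i - \<Lambda> j) * G x $ i $ j = \<phi>' x $ i * \<phi> x $ j - \<phi> x $ i * \<phi>' x $ j"
proof -
  have i: "integrable lborel (\<lambda>x. (\<Lambda> n * phi n x)\<^sup>2)" for n
    using L2 by (simp add: power_mult_distrib)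
  have "phi i x * phi' j x - phi' i x * phi j x = cumint (\<lambda>x. \<Lambda> i * phi i x * phi j x - phi i x * (\<Lambda> j * phi j x)) x"
    by (rule wronskian_eq_cumint(1)[OF lq sb eig eig _ _ L2 i L2 i]) (intro continuous_intros cphi)+
  also have "(\<lambda>x. \<Lambda> i * phi i x * phi j x - phi i x * (\<Lambda> j * phi j x)) = (\<lambda>x. (\<Lambda> i - \<Lambda> j) * (phi i x * phi j x))"
    by (auto simp: algebra_simps)
  finally show ?thesis by (cases "i = j") (simp_all add: G_nth cumint_cmult)
qed

lemma d_quad: "((\<lambda>x. y \<bullet> (G x *v y)) has_real_derivative - (\<phi> x \<bullet> y)\<^sup>2) (at x)"
proof -
  have "((\<lambda>x. G x *v y) has_vector_derivative G x *v 0 + (- outer (\<phi> x) (\<phi> x)) *v y) (at x)"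
    by (rule has_vector_derivative_matrix_vector_mult[OF dG has_vector_derivative_const])
  from has_real_derivative_inner[OF has_vector_derivative_const this, of y]
  show ?thesis
    by (simp add: bounded_bilinear.minus_left[OF bounded_bilinear_matrix_vector_mult] outer_mult_vec
        power2_eq_square inner_commute)
qed

lemma quad_eq: "y \<bullet> (G x *v y) = (\<Sum>i\<in>UNIV. \<Sum>j\<in>UNIV. y $ i * (G x $ i $ j * y $ j))"
  by (simp add: inner_vec_def matrix_vector_mult_def sum_distrib_left)

lemma quad_at_top: "((\<lambda>x. y \<bullet> (G x *v y)) \<longlongrightarrow> 0) at_top"
proof -
  have "((\<lambda>x. \<Sum>i\<in>UNIV. \<Sum>j\<in>UNIV. y $ i * (G x $ i $ j * y $ j)) \<longlongrightarrow> (\<Sum>i\<in>UNIV. \<Sum>j\<in>UNIV. y $ i * (0 * y $ j))) at_top"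
    by (intro tendsto_intros G_at_top)
  then show ?thesis by (simp add: quad_eq)
qed

lemma quad_at_bot: "((\<lambda>x. y \<bullet> (G x *v y)) \<longlongrightarrow> y \<bullet> y) at_bot"
proof -
  have "((\<lambda>x. \<Sum>i\<in>UNIV. \<Sum>j\<in>UNIV. y $ i * (G x $ i $ j * y $ j)) \<longlongrightarrow> (\<Sum>i\<in>UNIV. \<Sum>j\<in>UNIV. y $ i * (mat 1 $ i $ j * y $ j))) at_bot"
    by (intro tendsto_intros G_at_bot)
  moreover have "(\<Sum>i\<in>UNIV. \<Sum>j\<in>UNIV. y $ i * (mat 1 $ i $ j * y $ j)) = y \<bullet> (mat 1 *v y)"
    by (simp add: inner_vec_def matrix_vector_mult_def sum_distrib_left del: matrix_vector_mul_lid)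
  ultimately show ?thesis by (simp add: quad_eq)
qed

text \<open>By \<open>d_quad\<close> the quadratic form of \<open>G\<close> decreases along the
  line, from \<open>y \<bullet> y\<close> at -infinity to 0 at +infinity.\<close>

lemma quad_nonneg: "0 \<le> y \<bullet> (G x *v y)"
  and quad_le: "y \<bullet> (G x *v y) \<le> y \<bullet> y"
  and quad_antimono: "a \<le> b \<Longrightarrow> y \<bullet> (G b *v y) \<le> y \<bullet> (G a *v y)"
proof -
  note n = zero_le_power2[THEN neg_le_0_iff_le[THEN iffD2]]
  show "0 \<le> y \<bullet> (G x *v y)" by (rule antitone_limit_ge(1)[OF d_quad n quad_at_top])
  show "y \<bullet> (G x *v y) \<le> y \<bullet> y" by (rule antitone_limit_ge(2)[OF d_quad n quad_at_bot])
  show "a \<le> b \<Longrightarrow> y \<bullet> (G b *v y) \<le> y \<bullet> (G a *v y)" by (rule antitone_limit_ge(3)[OF d_quad n])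
qed

text \<open>A nonnegative decreasing function that vanishes at \<open>x\<close> vanishes from there
  on, and so does its derivative \<open>- (\<phi> s \<bullet> y)\<^sup>2\<close>. Continuity adds
  the endpoint \<open>s = x\<close>, the point at which the kernel argument uses the lemma.\<close>

lemma quad_zero:
  assumes "y \<bullet> (G x *v y) = 0" "x \<le> s"
  shows "\<phi> s \<bullet> y = 0" "\<phi>' s \<bullet> y = 0"
proof -
  have z: "\<phi> s \<bullet> y = 0" if s: "x < s" for s
  proof -
    have "y \<bullet> (G r *v y) = 0" if "r > x" for r
      using quad_nonneg[of y r] quad_antimono[of x r y] that assms(1) by linarith
    then have "((\<lambda>r. y \<bullet> (G r *v y)) has_real_derivative 0) (at s)"
      by (intro has_field_derivative_transform_within_open[OF DERIV_const[of 0], where S="{x<..}"]) (use s in auto)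
    then have "- (\<phi> s \<bullet> y)\<^sup>2 = 0" by (rule DERIV_unique[OF d_quad])
    then show ?thesis by simp
  qed
  have z': "\<phi>' s \<bullet> y = 0" if s: "x < s" for s
  proof -
    have "((\<lambda>r. \<phi> r \<bullet> y) has_real_derivative \<phi> s \<bullet> 0 + \<phi>' s \<bullet> y) (at s)"
      by (rule has_real_derivative_inner[OF d\<phi> has_vector_derivative_const])
    moreover have "((\<lambda>r. \<phi> r \<bullet> y) has_real_derivative 0) (at s)"
    proof -
      have "((\<lambda>_. 0) has_real_derivative 0) (at s)" by simp
      then show ?thesis
        by (rule has_field_derivative_transform_within_open[of _ _ _ "{x<..}"]) (use s z in auto)
    qed
    ultimately have "\<phi> s \<bullet> 0 + \<phi>' s \<bullet> y = 0" by (rule DERIV_unique)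
    then show ?thesis by simp
  qed
  have cl: "s \<in> closure {x<..}" using assms(2) by simp
  show "\<phi> s \<bullet> y = 0"
    by (rule continuous_constant_on_closure[OF _ _ cl]) (auto intro!: continuous_intros c\<phi> z)
  show "\<phi>' s \<bullet> y = 0"
    by (rule continuous_constant_on_closure[OF _ _ cl]) (auto intro!: continuous_intros c\<phi> z')
qed

text \<open>The kernel of \<open>G x\<close> is invariant under \<open>diag \<Lambda>\<close>, hence spanned by coordinate vectors.\<close>

lemma G_kernel: "G x *v a = 0 \<Longrightarrow> a = 0"
proof (induction "card {i. a $ i \<noteq> 0}" arbitrary: a rule: less_induct)
  case less
  show ?case
  proof (rule ccontr)
    assume "a \<noteq> 0"
    then obtain i where i: "a $ i \<noteq> 0" by (auto simp: vec_eq_iff)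
    have z: "\<phi> x \<bullet> a = 0" "\<phi>' x \<bullet> a = 0"
      using quad_zero[of a x x] less.prems by simp_all
    \<comment> \<open>Subtracting \<open>\<Lambda> i\<close> removes the coordinate \<open>i\<close>
      from the support, on whose size the induction runs. The vector stays in the kernel since the
      commutator applied to \<open>a\<close> involves only the vanishing numbers
      \<open>\<phi> x \<bullet> a\<close> and \<open>\<phi>' x \<bullet> a\<close>.\<close>
    define b where "b = (\<chi> j. (\<Lambda> j - \<Lambda> i) * a $ j)"
    have "G x *v b = 0"
    proof (simp add: vec_eq_iff, intro allI)
      fix k
      have "(G x *v b) $ k = (\<Sum>j\<in>UNIV. (\<Lambda> k - \<Lambda> i) * (G x $ k $ j * a $ j) - ((\<Lambda> k - \<Lambda> j) * G x $ k $ j) * a $ j)"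
        by (simp add: matrix_vector_mult_def b_def algebra_simps)
      also have "\<dots> = (\<Lambda> k - \<Lambda> i) * (G x *v a) $ k - (\<phi>' x $ k * (\<phi> x \<bullet> a) - \<phi> x $ k * (\<phi>' x \<bullet> a))"
        unfolding comm
        by (simp add: matrix_vector_mult_def inner_vec_def sum_subtractf sum.distrib sum_distrib_left algebra_simps)
      finally show "(G x *v b) $ k = 0" using less.prems z by simp
    qed
    moreover have "{j. b $ j \<noteq> 0} \<subset> {j. a $ j \<noteq> 0}"
      using i by (auto simp: b_def)
    then have "card {j. b $ j \<noteq> 0} < card {j. a $ j \<noteq> 0}"
      by (intro psubset_card_mono) auto
    ultimately have "b = 0" using less.hyps by blast
    then have "a $ j = 0" if "j \<noteq> i" for j
      using that inj_eig by (auto simp: b_def vec_eq_iff)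
    then have "\<phi> s \<bullet> a = phi i s * a $ i" "\<phi>' s \<bullet> a = phi' i s * a $ i" for s
      by (simp_all add: inner_vec_def sum.remove[of UNIV i])
    then have "phi i x = 0" "phi' i x = 0" using z i by auto
    then show False using sturm_zero[OF lq eig] phi_nonzero by blast
  qed
qed

lemma invertible_G: "invertible (G x)"
  using G_kernel[of x] unfolding invertible_left_inverse matrix_left_invertible_ker by blast

lemma GA: "G x *v (A x *v y) = y" and AG: "A x *v (G x *v y) = y"
  using matrix_inv_inverse[OF invertible_G[of x]]
  by (simp_all add: matrix_vector_mul_assoc A_def)

sublocale dc?: double_commutation q \<Lambda> \<phi> \<phi>' G A
proof
  fix x y z i j
  show "sturm q (\<lambda>x. \<Lambda> i * \<phi> x $ i) (\<lambda>x. \<phi> x $ i) (\<lambda>x. \<phi>' x $ i)" using eig by simp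
  show "(G has_vector_derivative - outer (\<phi> x) (\<phi> x)) (at x)" by (rule dG)
  have sA: "z \<bullet> (A x *v y) = y \<bullet> (A x *v z)" for y z by (metis GA inner_commute symG)
  have "A x ** (- outer (\<phi> x) (\<phi> x)) ** A x = - outer (A x *v \<phi> x) (A x *v \<phi> x)"
  proof -
    have "(A x ** (- outer (\<phi> x) (\<phi> x)) ** A x) *v y = (- outer (A x *v \<phi> x) (A x *v \<phi> x)) *v y" for y
      using sA[of "\<phi> x" y]
      by (simp add: matrix_vector_mul_assoc[symmetric] bounded_bilinear.minus_left[OF bounded_bilinear_matrix_vector_mult]
         bounded_bilinear.minus_right[OF bounded_bilinear_matrix_vector_mult] outer_mult_vec
         matrix_vector_mult_scaleR inner_commute)
    then show ?thesis by (simp add: matrix_eq)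
  qed
  then show "(A has_vector_derivative outer (A x *v \<phi> x) (A x *v \<phi> x)) (at x)"
    using matrix_inv_has_vector_derivative[OF dG invertible_G, of x]
    by (simp add: A_def[abs_def])
  show "y \<bullet> (G x *v z) = z \<bullet> (G x *v y)" by (rule symG)
  show "G x *v (A x *v y) = y" "A x *v (G x *v y) = y" by (rule GA AG)+
  show "(\<Lambda> i - \<Lambda> j) * G x $ i $ j = \<phi>' x $ i * \<phi> x $ j - \<phi> x $ i * \<phi>' x $ j" by (rule comm)
qed

text \<open>The determinant is continuous, never zero, and tends to 1 at -infinity, so it cannot
  change sign. This makes the logarithm in the new potential differentiable.\<close>

lemma det_G_pos: "det (G x) > 0"
proof -
  have nz: "det (G x) \<noteq> 0" for x using invertible_G invertible_det_nz by blast
  have "((\<lambda>x. det (G x)) \<longlongrightarrow> det (mat 1 :: real^'n^'n)) at_bot"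
    unfolding det_def by (intro tendsto_intros G_at_bot)
  then have "\<forall>\<^sub>F y in at_bot. det (G y) > 0"
    by (rule order_tendstoD) simp
  then obtain y where y: "y \<le> x" "det (G y) > 0"
    by (auto simp: eventually_at_bot_linorder) (metis linear order_refl order_trans)
  have "((\<lambda>t. G t $ i $ j) has_real_derivative (- outer (\<phi> t) (\<phi> t)) $ i $ j) (at t)" for i j t
    by (intro has_real_derivative_vec_nth has_vector_derivative_vec_nth dG)
  then have "isCont (\<lambda>t. det (G t)) t" for t
    using det_has_real_derivative[of G _ t] DERIV_isCont by blast
  then have "\<not> det (G x) < 0"
    using IVT2[of "\<lambda>t. det (G t)" x 0 y] y nz by force
  then show ?thesis using nz[of x] by linarith
qed

text \<open>Differentiating row \<open>i\<close> of \<open>G\<close> replaces it by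
  \<open>- phi i x\<close> times \<open>\<phi> x\<close>, which is \<open>G\<close> applied to a
  multiple of \<open>Phi x\<close>. After transposition Cramer's lemma evaluates each determinant,
  and the sum is \<open>- kap x * det (G x)\<close>.\<close>

lemma ln_det_deriv: "((\<lambda>y. ln (det (G y))) has_real_derivative - kap x) (at x)"
proof -
  have "((\<lambda>t. G t $ i $ j) has_real_derivative (- outer (\<phi> x) (\<phi> x)) $ i $ j) (at x)" for i j
    by (intro has_real_derivative_vec_nth has_vector_derivative_vec_nth dG)
  from det_has_real_derivative[OF this]
  have "((\<lambda>t. det (G t)) has_real_derivative
      (\<Sum>i\<in>UNIV. det (\<chi> k l. if k = i then (- outer (\<phi> x) (\<phi> x)) $ i $ l else G x $ k $ l))) (at x)" .
  also have "(\<Sum>i\<in>UNIV. det (\<chi> k l. if k = i then (- outer (\<phi> x) (\<phi> x)) $ i $ l else G x $ k $ l))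
     = (\<Sum>i\<in>UNIV. - (phi i x * Phi x $ i) * det (G x))"
  proof (rule sum.cong[OF refl])
    fix i
    have GP: "G x *v ((- phi i x) *\<^sub>R Phi x) = (- phi i x) *\<^sub>R \<phi> x"
      by (simp add: Phi_def GA matrix_vector_mult_scaleR del: scaleR_minus_left)
    have "det (\<chi> k l. if k = i then (- outer (\<phi> x) (\<phi> x)) $ i $ l else G x $ k $ l)
      = det (transpose (\<chi> k l. if k = i then (- outer (\<phi> x) (\<phi> x)) $ i $ l else G x $ k $ l))"
      by (simp add: det_transpose)
    also have "transpose (\<chi> k l. if k = i then (- outer (\<phi> x) (\<phi> x)) $ i $ l else G x $ k $ l)
      = (\<chi> k l. if l = i then (G x *v ((- phi i x) *\<^sub>R Phi x)) $ k else G x $ k $ l)"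
      unfolding GP by (simp add: transpose_def vec_eq_iff outer_def G_sym)
    also have "det \<dots> = ((- phi i x) *\<^sub>R Phi x) $ i * det (G x)"
      by (rule cramer_lemma)
    finally show "det (\<chi> k l. if k = i then (- outer (\<phi> x) (\<phi> x)) $ i $ l else G x $ k $ l)
      = - (phi i x * Phi x $ i) * det (G x)" by simp
  qed
  also have "\<dots> = - kap x * det (G x)"
    by (simp add: kap_def inner_vec_def sum_distrib_right sum_negf)
  finally have "((\<lambda>t. det (G t)) has_real_derivative - kap x * det (G x)) (at x)" .
  from DERIV_chain2[OF DERIV_ln[OF det_G_pos] this] show ?thesis
    by (rule DERIV_cong) (use det_G_pos[of x] in \<open>simp add: field_simps\<close>)
qed

lemma potential_eq:
  "q x - 2 * deriv (deriv (\<lambda>y. ln (det (mat 1 - Gminus phi y)))) x = q x + 2 * kap' x"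
proof -
  have "deriv (\<lambda>y. ln (det (mat 1 - Gminus phi y))) = (\<lambda>x. - kap x)"
    using DERIV_imp_deriv[OF ln_det_deriv] by (auto simp: G_def)
  moreover have "deriv (\<lambda>x. - kap x) x = - kap' x"
    by (intro DERIV_imp_deriv DERIV_minus dkap)
  ultimately show ?thesis by simp
qed

lemma energy_nonneg: "0 \<le> c \<bullet> (A x *v c)"
  using quad_nonneg[of "A x *v c" x] by (simp add: GA inner_commute)

section \<open>Transfer of eigenvalues in both directions\<close>

text \<open>As \<open>lam\<close> differs from every \<open>\<Lambda> n\<close>, \<open>u\<close> is
  orthogonal to all \<open>phi n\<close>; hence minus the integral up to \<open>x\<close> is the
  integral beyond \<open>x\<close>, and \<open>c\<close> vanishes at both ends with
  \<open>d = 0\<close>. If the transform were zero, \<open>A c\<close> would be constant and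
  \<open>u\<close> a combination of the \<open>phi n\<close>, hence orthogonal to itself.\<close>

lemma eigenvalue_forward:
  assumes u: "sturm q (\<lambda>x. lam * u x) u u'" "integrable lborel (\<lambda>x. (u x)\<^sup>2)" "u x0 \<noteq> 0"
    and lam: "\<And>n. lam \<noteq> \<Lambda> n"
  shows "\<exists>v v'. sturm (\<lambda>x. q x + 2 * kap' x) (\<lambda>x. lam * v x) v v' \<and>
     (\<exists>x. v x \<noteq> 0) \<and> integrable lborel (\<lambda>x. (v x)\<^sup>2)"
proof -
  note cu = sturm_continuous(1)[OF u(1)]
  have pu: "integrable lborel (\<lambda>x. phi n x * u x)" for n
    by (intro integrable_mult_of_squares cphi cu L2 u)
  have iF: "integrable lborel (\<lambda>x. (\<Lambda> n * phi n x)\<^sup>2)" "integrable lborel (\<lambda>x. (lam * u x)\<^sup>2)" for n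
    using L2 u(2) by (simp_all add: power_mult_distrib)
  have cF: "continuous_on UNIV (\<lambda>x. \<Lambda> n * phi n x)" "continuous_on UNIV (\<lambda>x. lam * u x)" for n
    by (intro continuous_intros cphi cu)+
  have eq: "(\<lambda>x. \<Lambda> n * phi n x * u x - phi n x * (lam * u x)) = (\<lambda>x. (\<Lambda> n - lam) * (phi n x * u x))" for n
    by (auto simp: algebra_simps)
  have W: "phi n x * u' x - phi' n x * u x = (\<Lambda> n - lam) * cumint (\<lambda>x. phi n x * u x) x" for n x
  proof -
    have "phi n x * u' x - phi' n x * u x = cumint (\<lambda>x. \<Lambda> n * phi n x * u x - phi n x * (lam * u x)) x"
      by (rule wronskian_eq_cumint(1)[OF lq sb eig u(1) cF L2 iF(1) u(2) iF(2)])
    then show ?thesis unfolding eq cumint_cmult .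
  qed
  have orth_u: "(LINT x|lborel. phi n x * u x) = 0" for n
  proof -
    have "(LINT x|lborel. \<Lambda> n * phi n x * u x - phi n x * (lam * u x)) = 0"
      by (rule wronskian_eq_cumint(2)[OF lq sb eig u(1) cF L2 iF(1) u(2) iF(2)])
    then show ?thesis unfolding eq using lam[of n] by simp
  qed
  define c where "c x = (\<chi> n. - cumint (\<lambda>x. phi n x * u x) x)" for x
  have dc: "(c has_vector_derivative (- u x) *\<^sub>R \<phi> x) (at x)" for x
  proof (rule has_vector_derivative_vecI)
    fix n
    have "((\<lambda>x. - cumint (\<lambda>x. phi n x * u x) x) has_real_derivative - (phi n x * u x)) (at x)"
      by (intro DERIV_minus cumint_deriv continuous_intros cphi cu pu)
    then show "((\<lambda>t. c t $ n) has_real_derivative ((- u x) *\<^sub>R \<phi> x) $ n) (at x)"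
      by (simp add: c_def mult.commute)
  qed
  define v where "v x = u x - Phi x \<bullet> c x" for x
  define v' where "v' x = u' x + kap x * (u x - Phi x \<bullet> c x) - \<phi>' x \<bullet> (A x *v c x)" for x
  have "sturm (\<lambda>x. q x + 2 * kap' x) (\<lambda>x. lam * (u x - Phi x \<bullet> c x) - Phi x \<bullet> 0)
     (\<lambda>x. u x - Phi x \<bullet> c x) (\<lambda>x. u' x + kap x * (u x - Phi x \<bullet> c x) - \<phi>' x \<bullet> (A x *v c x))"
  proof (rule transform[OF dc u(1)])
    fix n x
    show "(\<Lambda> n - lam) * c x $ n = \<phi>' x $ n * u x - \<phi> x $ n * u' x + (0 :: real^'n) $ n"
      using W[of n x] by (simp add: c_def)
  qed
  then have v: "sturm (\<lambda>x. q x + 2 * kap' x) (\<lambda>x. lam * v x) v v'"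
    by (simp add: v_def[abs_def] v'_def[abs_def])
  have cv: "continuous_on S v" for S by (rule sturm_continuous(1)[OF v])
  have energy: "((\<lambda>x. c x \<bullet> (A x *v c x)) has_real_derivative (v x)\<^sup>2 - (u x)\<^sup>2) (at x)" for x
    unfolding v_def by (rule d_energy[OF dc])
  have iu2: "continuous_on S (\<lambda>x. (u x)\<^sup>2)" for S by (intro continuous_intros cu)
  define U where "U = (LINT x|lborel. (u x)\<^sup>2)"
  have bessel: "c x \<bullet> (A x *v c x) \<le> U" for x
  proof -
    define y where "y = A x *v c x"
    \<comment> \<open>\<open>R t\<close> is the integral of
      \<open>(u - \<phi> \<bullet> y)\<^sup>2\<close> beyond \<open>t\<close>, recognised by its
      derivative and its limit 0. For \<open>y = A x *v c x\<close> and \<open>t = x\<close> it is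
      the residual of the projection of \<open>u\<close> onto the span of the \<open>phi n\<close>
      on that half-line.\<close>
    define R where "R t = U - cumint (\<lambda>x. (u x)\<^sup>2) t - 2 * (c t \<bullet> y) + y \<bullet> (G t *v y)" for t
    have dR: "(R has_real_derivative - (u t - \<phi> t \<bullet> y)\<^sup>2) (at t)" for t
    proof -
      have "(R has_real_derivative 0 - (u t)\<^sup>2 - 2 * (c t \<bullet> 0 + ((- u t) *\<^sub>R \<phi> t) \<bullet> y) + (- (\<phi> t \<bullet> y)\<^sup>2)) (at t)"
        unfolding R_def
        by (intro DERIV_add DERIV_diff DERIV_const DERIV_cmult d_quad cumint_deriv iu2 u(2)
            has_real_derivative_inner[OF dc has_vector_derivative_const])
      then show ?thesis
        by (rule DERIV_cong) (simp add: power2_eq_square algebra_simps)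
    qed
    have "((\<lambda>t. c t $ n) \<longlongrightarrow> 0) at_top" for n
      using tendsto_minus[OF cumint_at_top[OF pu[of n]]] by (simp add: c_def orth_u)
    then have "((\<lambda>t. \<Sum>n\<in>UNIV. c t $ n * y $ n) \<longlongrightarrow> (\<Sum>n\<in>UNIV. 0 * y $ n)) at_top"
      by (intro tendsto_intros)
    then have "((\<lambda>t. c t \<bullet> y) \<longlongrightarrow> 0) at_top" by (simp add: inner_vec_def)
    then have "(R \<longlongrightarrow> U - U - 2 * 0 + 0) at_top"
      unfolding R_def U_def by (intro tendsto_intros quad_at_top cumint_at_top u(2))
    then have "0 \<le> R x"
      using antitone_limit_ge(1)[of R "\<lambda>t. - (u t - \<phi> t \<bullet> y)\<^sup>2" 0 x] dR by simp
    moreover have "y \<bullet> (G x *v y) = c x \<bullet> y" by (simp add: y_def GA inner_commute)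
    moreover have "0 \<le> cumint (\<lambda>x. (u x)\<^sup>2) x"
      unfolding cumint_def set_lebesgue_integral_def by (rule Bochner_Integration.integral_nonneg) auto
    ultimately show ?thesis unfolding R_def y_def by linarith
  qed
  have "integrable lborel (\<lambda>x. (v x)\<^sup>2)"
  proof (rule integrable_of_bounded_integrals)
    fix a b :: real assume ab: "a \<le> b"
    have "((\<lambda>x. ((v x)\<^sup>2 - (u x)\<^sup>2) + (u x)\<^sup>2) has_integral
        (c b \<bullet> (A b *v c b) - c a \<bullet> (A a *v c a)) + integral {a..b} (\<lambda>x. (u x)\<^sup>2)) {a..b}"
      by (intro has_integral_add integral_of_derivative[OF energy ab] integrable_integral
         integrable_continuous_real iu2)
    then have "integral {a..b} (\<lambda>x. (v x)\<^sup>2) = (c b \<bullet> (A b *v c b) - c a \<bullet> (A a *v c a)) + integral {a..b} (\<lambda>x. (u x)\<^sup>2)"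
      by (simp add: integral_unique)
    also have "\<dots> \<le> U + U"
      using bessel[of b] energy_nonneg[of "c a" a] integral_le_LINT[OF u(2), of a b] by (simp add: U_def)
    finally show "integral {a..b} (\<lambda>x. (v x)\<^sup>2) \<le> U + U" .
  qed (auto intro!: continuous_intros cv)
  moreover have "\<exists>x. v x \<noteq> 0"
  proof (rule ccontr)
    assume "\<not> ?thesis"
    then have v0: "v x = 0" for x by simp
    have "((\<lambda>x. (A x *v c x) $ n) has_real_derivative 0) (at x)" for n x
      using has_real_derivative_vec_nth[OF dAc[OF dc], of n x] v0[of x] by (simp add: v_def)
    then have "(A x *v c x) $ n = (A 0 *v c 0) $ n" for n x
      using DERIV_isconst_all[of "\<lambda>x. (A x *v c x) $ n" x 0] by blast
    then have Ac: "A x *v c x = A 0 *v c 0" for x by (simp add: vec_eq_iff)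
    define e where "e = A 0 *v c 0"
    have ue: "u x = (\<Sum>n\<in>UNIV. phi n x * e $ n)" for x
      using v0[of x] Phi_inner[OF dc, of x "c x"] Ac[of x] by (simp add: v_def e_def inner_vec_def)
    have "(LINT x|lborel. (u x)\<^sup>2) = (LINT x|lborel. (\<Sum>n\<in>UNIV. e $ n * (phi n x * u x)))"
    proof (rule Bochner_Integration.integral_cong[OF refl])
      fix x
      have "(u x)\<^sup>2 = (\<Sum>n\<in>UNIV. phi n x * e $ n) * u x" by (simp add: power2_eq_square flip: ue)
      then show "(u x)\<^sup>2 = (\<Sum>n\<in>UNIV. e $ n * (phi n x * u x))"
        by (simp add: sum_distrib_left sum_distrib_right mult_ac)
    qed
    also have "\<dots> = (\<Sum>n\<in>UNIV. e $ n * (LINT x|lborel. phi n x * u x))"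
      using pu by (subst Bochner_Integration.integral_sum) auto
    finally have "(LINT x|lborel. (u x)\<^sup>2) = 0" by (simp add: orth_u)
    then show False using LINT_square_eq_0[OF cu u(2)] u(3) by blast
  qed
  ultimately show ?thesis using v by blast
qed

lemma \<phi>_inner_L2: "integrable lborel (\<lambda>x. (\<phi> x \<bullet> y)\<^sup>2)"
proof -
  have "(\<phi> x \<bullet> y)\<^sup>2 = (\<Sum>i\<in>UNIV. \<Sum>j\<in>UNIV. (y $ i * y $ j) * (phi i x * phi j x))" for x
    by (simp add: inner_vec_def power2_eq_square sum_product mult_ac)
  then show ?thesis using phi_mult_integrable by simp
qed

lemma LINT_phi_\<phi>_inner: "(LINT x|lborel. phi n x * (\<phi> x \<bullet> y)) = y $ n"
proof -
  have "(\<lambda>x. phi n x * (\<phi> x \<bullet> y)) = (\<lambda>x. \<Sum>i\<in>UNIV. y $ i * (phi n x * phi i x))"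
    by (simp add: inner_vec_def sum_distrib_left mult_ac)
  then have "(LINT x|lborel. phi n x * (\<phi> x \<bullet> y)) = (\<Sum>i\<in>UNIV. y $ i * (LINT x|lborel. phi n x * phi i x))"
    using phi_mult_integrable by (simp add: Bochner_Integration.integral_sum)
  then show ?thesis by (simp add: orth if_distrib[of "\<lambda>z. _ * z"] cong: if_cong)
qed

text \<open>The energy identity for \<open>u = 0\<close> and the constant vector
  \<open>c = y\<close>, whose transform is \<open>- (Phi x \<bullet> y)\<close>.\<close>

lemma d_quad_A: "((\<lambda>x. y \<bullet> (A x *v y)) has_real_derivative (Phi x \<bullet> y)\<^sup>2) (at x)"
  using d_energy[of "\<lambda>_. y" "\<lambda>_. 0" x] by simp

text \<open>As \<open>x\<close> tends to infinity, \<open>y \<bullet> A y\<close> is unbounded because \<open>G\<close> tends to \<open>0\<close>.\<close>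

lemma Phi_not_L2:
  assumes i: "integrable lborel (\<lambda>x. (Phi x \<bullet> y)\<^sup>2)"
  shows "y = 0"
proof -
  define K where "K = y \<bullet> (A 0 *v y) + (LINT x|lborel. (Phi x \<bullet> y)\<^sup>2)"
  have K: "y \<bullet> (A x *v y) \<le> K" if "x \<ge> 0" for x
    using integral_of_derivative[OF d_quad_A that, of y] integral_le_LINT[OF i, of 0 x]
    by (simp add: integral_unique K_def)
  \<comment> \<open>Positivity of \<open>G\<close> is tested with \<open>A y - t y\<close>. The term
    quadratic in \<open>t\<close> carries the factor \<open>y \<bullet> G y\<close> and disappears
    as \<open>x\<close> grows, which leaves a bound linear in \<open>t\<close>.\<close>
  have "2 * t * (y \<bullet> y) \<le> K" for t
  proof -
    have "0 \<le> K - 2 * t * (y \<bullet> y) + t\<^sup>2 * (y \<bullet> (G x *v y))" if "x \<ge> 0" for x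
    proof -
      have "0 \<le> (A x *v y - t *\<^sub>R y) \<bullet> (G x *v (A x *v y - t *\<^sub>R y))" by (rule quad_nonneg)
      also have "\<dots> = y \<bullet> (A x *v y) - 2 * t * (y \<bullet> y) + t\<^sup>2 * (y \<bullet> (G x *v y))"
        using symG[of "A x *v y" x y]
        by (simp add: matrix_vector_mult_diff_distrib matrix_vector_mult_scaleR GA inner_diff_left
            inner_diff_right inner_commute power2_eq_square algebra_simps)
      finally show ?thesis using K[OF that] by linarith
    qed
    then have ev: "\<forall>\<^sub>F x in at_top. 0 \<le> K - 2 * t * (y \<bullet> y) + t\<^sup>2 * (y \<bullet> (G x *v y))"
      by (auto intro: eventually_mono[OF eventually_ge_at_top[of 0]])
    have "((\<lambda>x. K - 2 * t * (y \<bullet> y) + t\<^sup>2 * (y \<bullet> (G x *v y))) \<longlongrightarrow> K - 2 * t * (y \<bullet> y) + t\<^sup>2 * 0) at_top"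
      by (intro tendsto_intros quad_at_top)
    from tendsto_lowerbound[OF this ev trivial_limit_at_top_linorder]
    have "0 \<le> K - 2 * t * (y \<bullet> y) + t\<^sup>2 * 0" .
    then show ?thesis by simp
  qed
  note * = this
  show "y = 0"
  proof (rule ccontr)
    assume "y \<noteq> 0"
    then obtain r where r: "r = y \<bullet> y" "r > 0" by simp
    with *[of "(K + 1) / (2 * r)"] show False unfolding r(1)[symmetric] by simp
  qed
qed

text \<open>The dual energy is \<open>- (c \<bullet> G c)\<close>, so \<open>u\<close> is square
  integrable once \<open>c \<bullet> G c\<close> is bounded towards -infinity; there
  \<open>G\<close> is at most the identity and \<open>c\<close> is bounded. Both
  \<open>u \<noteq> 0\<close> and \<open>lam \<noteq> \<Lambda> n\<close> come from one fact:
  \<open>u\<close> is no combination of the \<open>phi n\<close>.\<close>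

lemma eigenvalue_backward:
  assumes v: "sturm (\<lambda>x. q x + 2 * kap' x) (\<lambda>x. lam * v x) v v'"
      "integrable lborel (\<lambda>x. (v x)\<^sup>2)" "v x0 \<noteq> 0"
  shows "(\<forall>n. lam \<noteq> \<Lambda> n) \<and> (\<exists>u u'. sturm q (\<lambda>x. lam * u x) u u' \<and>
     (\<exists>x. u x \<noteq> 0) \<and> integrable lborel (\<lambda>x. (u x)\<^sup>2))"
proof -
  interpret D: double_commutation "\<lambda>x. q x + 2 * kap' x" \<Lambda> Phi Phi' "\<lambda>x. - A x" "\<lambda>x. - G x"
    by (rule dual)
  note neg = bounded_bilinear.minus_left[OF bounded_bilinear_matrix_vector_mult]
    bounded_bilinear.minus_right[OF bounded_bilinear_matrix_vector_mult]
  have cv: "continuous_on S v" for S by (rule sturm_continuous(1)[OF v(1)])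
  have cPhi: "continuous_on S (\<lambda>x. Phi x $ n)" for S n by (intro continuous_intros continuous_Phi)
  have "\<exists>F. \<forall>x. (F has_real_derivative - (v x * Phi x $ n)) (at x)" for n
    by (intro antiderivative_exists continuous_intros cv cPhi)
  then obtain F where F: "\<And>n x. (F n has_real_derivative - (v x * Phi x $ n)) (at x)" by metis
  have dW: "((\<lambda>x. Phi x $ n * v' x - Phi' x $ n * v x) has_real_derivative (\<Lambda> n - lam) * (v x * Phi x $ n)) (at x)" for n x
  proof -
    have "indef (\<lambda>x. \<Lambda> n * Phi x $ n * v x - Phi x $ n * (lam * v x)) (\<lambda>x. Phi x $ n * v' x - Phi' x $ n * v x)"
      by (rule sturm_wronskian[OF Phi_sturm v(1)])
    then have "((\<lambda>x. Phi x $ n * v' x - Phi' x $ n * v x) has_real_derivative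
        \<Lambda> n * Phi x $ n * v x - Phi x $ n * (lam * v x)) (at x)"
      by (rule indef_deriv) (intro continuous_intros cv cPhi)
    then show ?thesis by (rule DERIV_cong) (simp add: algebra_simps)
  qed
  \<comment> \<open>By Lagrange's identity the Wronskian of \<open>Phi n\<close> and
    \<open>v\<close> plus \<open>(\<Lambda> n - lam) * F n\<close> is constant; this is its
    value.\<close>
  define d0 where "d0 n = Phi 0 $ n * v' 0 - Phi' 0 $ n * v 0 + (\<Lambda> n - lam) * F n 0" for n
  have d0: "Phi x $ n * v' x - Phi' x $ n * v x + (\<Lambda> n - lam) * F n x = d0 n" for n x
  proof -
    have "((\<lambda>x. Phi x $ n * v' x - Phi' x $ n * v x + (\<Lambda> n - lam) * F n x) has_real_derivative 0) (at x)" for x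
      using DERIV_add[OF dW DERIV_cmult[OF F]] by (rule DERIV_cong) simp
    then show ?thesis
      using DERIV_isconst_all[of "\<lambda>x. Phi x $ n * v' x - Phi' x $ n * v x + (\<Lambda> n - lam) * F n x" x 0]
      unfolding d0_def by blast
  qed
  \<comment> \<open>For \<open>\<Lambda> n = lam\<close> the quotient below is \<open>0\<close>.\<close>
  define c where "c x = (\<chi> n. F n x - d0 n / (\<Lambda> n - lam))" for x
  \<comment> \<open>Shifting \<open>c\<close> has absorbed \<open>d0 n\<close> wherever
    \<open>\<Lambda> n\<close> differs from \<open>lam\<close>; only the remaining indices are
    left.\<close>
  define d where "d = (\<chi> n. if \<Lambda> n = lam then d0 n else 0)"
  have dc: "(c has_vector_derivative (- v x) *\<^sub>R Phi x) (at x)" for x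
  proof (rule has_vector_derivative_vecI)
    fix n
    have "((\<lambda>x. F n x - d0 n / (\<Lambda> n - lam)) has_real_derivative - (v x * Phi x $ n) - 0) (at x)"
      by (intro DERIV_diff DERIV_const F)
    then show "((\<lambda>t. c t $ n) has_real_derivative ((- v x) *\<^sub>R Phi x) $ n) (at x)"
      by (simp add: c_def)
  qed
  have cc: "(\<Lambda> n - lam) * c x $ n = Phi' x $ n * v x - Phi x $ n * v' x + d $ n" for n x
    using d0[of x n] by (auto simp: c_def d_def right_diff_distrib)
  have DPhi: "D.Phi x = - \<phi> x" for x by (rule dual_Phi)
  define u where "u x = v x - D.Phi x \<bullet> c x" for x
  define u' where "u' x = v' x + D.kap x * (v x - D.Phi x \<bullet> c x) - Phi' x \<bullet> (- G x *v c x)" for x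
  have u0: "sturm q (\<lambda>x. lam * u x + \<phi> x \<bullet> d) u u'"
  proof -
    have "sturm (\<lambda>x. q x + 2 * kap' x + 2 * D.kap' x) (\<lambda>x. lam * u x - D.Phi x \<bullet> d) u u'"
      unfolding u_def[abs_def] u'_def[abs_def] by (rule D.transform[OF dc v(1) cc])
    then show ?thesis by (simp add: dual_potential DPhi)
  qed
  have u_eq: "u x = v x + \<phi> x \<bullet> c x" for x by (simp add: u_def DPhi)
  have cu: "continuous_on S u" for S by (rule sturm_continuous(1)[OF u0])
  have energy: "((\<lambda>x. - (c x \<bullet> (G x *v c x))) has_real_derivative (u x)\<^sup>2 - (v x)\<^sup>2) (at x)" for x
    using D.d_energy[OF dc, of x] by (simp add: u_def neg)
  define V where "V = (LINT x|lborel. (v x)\<^sup>2)"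
  have V0: "0 \<le> V" unfolding V_def by (rule Bochner_Integration.integral_nonneg) simp
  \<comment> \<open>The components of \<open>Phi\<close> are square integrable towards -infinity:
    the integral of the square over \<open>{a..0}\<close> is a difference of two values of the
    nonnegative form of \<open>A\<close>, hence at most the value at 0.\<close>
  have cbound: "\<bar>c a $ n\<bar> \<le> \<bar>c 0 $ n\<bar> + (axis n 1 \<bullet> (A 0 *v axis n 1) + V)" if a: "a \<le> 0" for a n
  proof -
    have iP: "((\<lambda>x. (Phi x \<bullet> axis n 1)\<^sup>2) has_integral axis n 1 \<bullet> (A 0 *v axis n 1) - axis n 1 \<bullet> (A a *v axis n 1)) {a..0}"
      by (rule integral_of_derivative[OF d_quad_A a])
    have ic: "((\<lambda>x. - (v x * Phi x $ n)) has_integral c 0 $ n - c a $ n) {a..0}"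
      using integral_of_derivative[OF F a] by (simp add: c_def)
    have iv: "(\<lambda>x. (v x)\<^sup>2) integrable_on {a..0}"
      by (intro integrable_continuous_real continuous_intros cv)
    have "norm (c 0 $ n - c a $ n) \<le> integral {a..0} (\<lambda>x. (Phi x \<bullet> axis n 1)\<^sup>2 + (v x)\<^sup>2)"
      unfolding integral_unique[OF ic, symmetric]
    proof (rule integral_norm_bound_integral)
      show "(\<lambda>x. - (v x * Phi x $ n)) integrable_on {a..0}" using ic by blast
      show "(\<lambda>x. (Phi x \<bullet> axis n 1)\<^sup>2 + (v x)\<^sup>2) integrable_on {a..0}"
        using iP iv by (intro integrable_add) auto
      fix x
      show "norm (- (v x * Phi x $ n)) \<le> (Phi x \<bullet> axis n 1)\<^sup>2 + (v x)\<^sup>2"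
        using sum_squares_bound[of "Phi x $ n" "v x"] sum_squares_bound[of "Phi x $ n" "- v x"]
          zero_le_power2[of "Phi x $ n"] zero_le_power2[of "v x"]
        unfolding real_norm_def inner_axis by (simp add: abs_le_iff mult.commute)
    qed
    also have "\<dots> = (axis n 1 \<bullet> (A 0 *v axis n 1) - axis n 1 \<bullet> (A a *v axis n 1)) + integral {a..0} (\<lambda>x. (v x)\<^sup>2)"
      using iP iv by (subst Henstock_Kurzweil_Integration.integral_add) (auto simp: integral_unique)
    also have "\<dots> \<le> axis n 1 \<bullet> (A 0 *v axis n 1) + V"
      using energy_nonneg[of "axis n 1" a] integral_le_LINT[OF v(2), of a 0] by (simp add: V_def)
    finally show ?thesis unfolding real_norm_def by linarith
  qed
  define B where "B = (\<Sum>n\<in>UNIV. (\<bar>c 0 $ n\<bar> + (axis n 1 \<bullet> (A 0 *v axis n 1) + V))\<^sup>2)"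
  have cB: "c a \<bullet> (G a *v c a) \<le> B" if a: "a \<le> 0" for a
  proof -
    have "c a \<bullet> (G a *v c a) \<le> c a \<bullet> c a" by (rule quad_le)
    also have "\<dots> = (\<Sum>n\<in>UNIV. \<bar>c a $ n\<bar>\<^sup>2)" by (simp add: inner_vec_def power2_eq_square)
    also have "\<dots> \<le> B" unfolding B_def by (intro sum_mono power_mono cbound[OF a]) auto
    finally show ?thesis .
  qed
  have cv2: "continuous_on S (\<lambda>x. (v x)\<^sup>2)" and cu2: "continuous_on S (\<lambda>x. (u x)\<^sup>2)" for S
    by (intro continuous_intros cv cu)+
  have uL2: "integrable lborel (\<lambda>x. (u x)\<^sup>2)"
  proof (rule integrable_of_bounded_integrals[OF cu2])
    fix a b :: real assume ab: "a \<le> b"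
    \<comment> \<open>The bound on \<open>c \<bullet> G c\<close> holds only left of 0, so the
      interval is enlarged to start there; the integral of a square can only grow.\<close>
    define m where "m = min a 0"
    have m: "m \<le> 0" "m \<le> a" "m \<le> b" using ab by (auto simp: m_def)
    have "integral {a..b} (\<lambda>x. (u x)\<^sup>2) \<le> integral {m..b} (\<lambda>x. (u x)\<^sup>2)"
      using m by (intro integral_subset_le integrable_continuous_real cu2) auto
    also have "((\<lambda>x. ((u x)\<^sup>2 - (v x)\<^sup>2) + (v x)\<^sup>2) has_integral
        (- (c b \<bullet> (G b *v c b)) - - (c m \<bullet> (G m *v c m))) + integral {m..b} (\<lambda>x. (v x)\<^sup>2)) {m..b}"
      by (intro has_integral_add integral_of_derivative[OF energy m(3)] integrable_integral
         integrable_continuous_real cv2)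
    then have "integral {m..b} (\<lambda>x. (u x)\<^sup>2) = c m \<bullet> (G m *v c m) - c b \<bullet> (G b *v c b) + integral {m..b} (\<lambda>x. (v x)\<^sup>2)"
      by (simp add: integral_unique)
    also have "\<dots> \<le> B + V"
      using cB[OF m(1)] quad_nonneg[of "c b" b] integral_le_LINT[OF v(2), of m b] by (simp add: V_def)
    finally show "integral {a..b} (\<lambda>x. (u x)\<^sup>2) \<le> B + V" .
  qed simp
  have cphid: "continuous_on S (\<lambda>x. \<phi> x \<bullet> d)" for S by (intro continuous_intros c\<phi>)
  have "d $ n = 0" for n
  proof (cases "\<Lambda> n = lam")
    case True
    have iH: "integrable lborel (\<lambda>x. (lam * u x + \<phi> x \<bullet> d)\<^sup>2)"
      using integrable_square_add[OF cu cphid uL2 \<phi>_inner_L2, of lam 1] by simp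
    \<comment> \<open>Over \<open>q\<close> the Wronskian of \<open>phi n\<close> and
      \<open>u\<close> vanishes at both ends. With \<open>\<Lambda> n = lam\<close> only the
      inhomogeneous term is left under the integral, and orthonormality reads off
      \<open>d $ n\<close>.\<close>
    have "(LINT x|lborel. \<Lambda> n * phi n x * u x - phi n x * (lam * u x + \<phi> x \<bullet> d)) = 0"
      by (rule wronskian_eq_cumint(2)[OF lq sb eig u0 _ _ L2 _ uL2 iH])
         (use L2 in \<open>auto intro!: continuous_intros cphi cu cphid simp: power_mult_distrib\<close>)
    moreover have "\<Lambda> n * phi n x * u x - phi n x * (lam * u x + \<phi> x \<bullet> d) = - (phi n x * (\<phi> x \<bullet> d))" for x
      using True by (simp add: algebra_simps)
    ultimately show ?thesis using LINT_phi_\<phi>_inner[of n d] by simp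
  qed (simp add: d_def)
  then have "d = 0" by (simp add: vec_eq_iff)
  with u0 have u: "sturm q (\<lambda>x. lam * u x) u u'" by simp
  \<comment> \<open>If \<open>u = \<phi> \<bullet> a\<close>, then \<open>G (c - a)\<close> has
    derivative zero, so \<open>c - a = A b\<close> with a constant \<open>b\<close>, and
    \<open>v = - (Phi \<bullet> b)\<close> would be a nonzero square integrable combination of the
    components of \<open>Phi\<close>.\<close>
  have no: "\<not> (\<forall>x. u x = \<phi> x \<bullet> a)" for a
  proof
    assume ua: "\<forall>x. u x = \<phi> x \<bullet> a"
    have "((\<lambda>x. G x *v (c x - a)) has_vector_derivative
        G x *v ((- v x) *\<^sub>R Phi x - 0) + (- outer (\<phi> x) (\<phi> x)) *v (c x - a)) (at x)" for x
      by (intro has_vector_derivative_matrix_vector_mult dG has_vector_derivative_diff dc has_vector_derivative_const)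
    moreover have "G x *v ((- v x) *\<^sub>R Phi x - 0) + (- outer (\<phi> x) (\<phi> x)) *v (c x - a) = 0" for x
    proof -
      have "G x *v ((- v x) *\<^sub>R Phi x - 0) = (- v x) *\<^sub>R \<phi> x"
        by (simp add: Phi_def matrix_vector_mult_scaleR GA del: scaleR_minus_left)
      moreover have "(- outer (\<phi> x) (\<phi> x)) *v (c x - a) = v x *\<^sub>R \<phi> x"
        using ua u_eq[of x] by (simp add: neg outer_mult_vec inner_diff_right flip: scaleR_minus_left)
      ultimately show ?thesis by simp
    qed
    ultimately have "((\<lambda>x. (G x *v (c x - a)) $ n) has_real_derivative 0) (at x)" for n x
      using has_real_derivative_vec_nth by fastforce
    then have "(G x *v (c x - a)) $ n = (G 0 *v (c 0 - a)) $ n" for n x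
      using DERIV_isconst_all[of "\<lambda>x. (G x *v (c x - a)) $ n" x 0] by blast
    then have "G x *v (c x - a) = G 0 *v (c 0 - a)" for x by (simp add: vec_eq_iff)
    then obtain b where "\<And>x. G x *v (c x - a) = b" by blast
    then have cab: "c x - a = A x *v b" for x by (metis AG)
    have vb: "v x = - (Phi x \<bullet> b)" for x
    proof -
      have "v x = - (\<phi> x \<bullet> (c x - a))" using ua u_eq[of x] by (simp add: inner_diff_right)
      also have "\<phi> x \<bullet> (c x - a) = Phi x \<bullet> b"
        using symA[of "\<phi> x" x b] by (simp add: cab Phi_def inner_commute)
      finally show ?thesis .
    qed
    then have "integrable lborel (\<lambda>x. (Phi x \<bullet> b)\<^sup>2)" using v(2) by simp
    then have "b = 0" by (rule Phi_not_L2)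
    then show False using vb v(3) by simp
  qed
  have "lam \<noteq> \<Lambda> n" for n
  proof
    assume l: "lam = \<Lambda> n"
    obtain x where x: "phi n x \<noteq> 0" using phi_nonzero by blast
    obtain a where a: "\<And>x. u x = a * phi n x"
      using L2_solution_unique[OF lq sb eig L2 x u[unfolded l] uL2] by blast
    have "\<forall>x. u x = \<phi> x \<bullet> (a *\<^sub>R axis n 1)" by (simp add: a inner_axis)
    then show False using no by blast
  qed
  moreover have "\<exists>x. u x \<noteq> 0" using no[of 0] by auto
  ultimately show ?thesis using u uL2 by blast
qed

end

section \<open>Complex eigenfunctions and real solutions\<close>

lemma sl_sol_of_sturm:
  assumes "sturm q (\<lambda>x. lam * u x) u u'"
  shows "sl_sol q (complex_of_real lam) (\<lambda>x. complex_of_real (u x)) (\<lambda>x. complex_of_real (u' x))"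
  unfolding sl_sol_def
proof (intro conjI allI impI)
  fix x y :: real
  show "((\<lambda>x. complex_of_real (u x)) has_vector_derivative complex_of_real (u' x)) (at x)"
    using sturm_deriv[OF assms, of x]
    by (intro has_vector_derivative_of_real) (simp add: has_real_derivative_iff_has_vector_derivative)
  assume "x \<le> y"
  from has_integral_of_real[OF indef_int[OF sturm_indef[OF assms] this]]
  show "((\<lambda>s. (complex_of_real (q s) - complex_of_real lam) * complex_of_real (u s)) has_integral
      complex_of_real (u' y) - complex_of_real (u' x)) {x..y}"
    by (simp add: left_diff_distrib)
qed

text \<open>\<open>h\<close> stands for \<open>Re\<close> or \<open>Im\<close>: as \<open>q\<close>
  and \<open>lam\<close> are real, taking either part commutes with the equation.\<close>

lemma sturm_of_sl_sol:
  assumes q: "locally_integrable q" and u: "sl_sol q (complex_of_real lam) u u'"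
    and h: "bounded_linear h" "\<And>r z. h (complex_of_real r * z) = r * h z"
  shows "sturm q (\<lambda>x. lam * h (u x)) (\<lambda>x. h (u x)) (\<lambda>x. h (u' x))"
proof -
  have du: "((\<lambda>x. h (u x)) has_real_derivative h (u' x)) (at x)" for x
    using bounded_linear.has_vector_derivative[OF h(1)] u
    by (auto simp: sl_sol_def has_real_derivative_iff_has_vector_derivative)
  have ch: "continuous_on S (\<lambda>x. h (u x))" for S
    by (rule DERIV_continuous_on[OF has_field_derivative_at_within[OF du]])
  have "indef (\<lambda>x. q x * h (u x) - lam * h (u x)) (\<lambda>x. h (u' x))"
  proof (rule indefI)
    fix a b :: real assume "a \<le> b"
    show "(\<lambda>x. q x * h (u x) - lam * h (u x)) absolutely_integrable_on {a..b}"
    proof (rule set_integral_diff(1))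
      show "(\<lambda>x. q x * h (u x)) absolutely_integrable_on {a..b}"
        by (rule locally_integrable_mult_continuous[OF q ch])
      show "(\<lambda>x. lam * h (u x)) absolutely_integrable_on {a..b}"
        by (intro absolutely_integrable_continuous_real continuous_intros ch)
    qed
    have "((\<lambda>s. (complex_of_real (q s) - complex_of_real lam) * u s) has_integral (u' b - u' a)) {a..b}"
      using u \<open>a \<le> b\<close> by (simp add: sl_sol_def)
    from has_integral_linear[OF this h(1)]
    have "((\<lambda>s. h ((complex_of_real (q s) - complex_of_real lam) * u s)) has_integral h (u' b) - h (u' a)) {a..b}"
      by (simp add: o_def linear_diff[OF bounded_linear.linear[OF h(1)]])
    moreover have "h ((complex_of_real (q s) - complex_of_real lam) * u s) = q s * h (u s) - lam * h (u s)" for s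
      using h(2)[of "q s - lam" "u s"] by (simp add: left_diff_distrib)
    ultimately show "((\<lambda>x. q x * h (u x) - lam * h (u x)) has_integral h (u' b) - h (u' a)) {a..b}" by simp
  qed
  then show ?thesis using du by (simp add: sturm_def)
qed

lemma is_eigenvalue_iff_sturm:
  assumes q: "locally_integrable q"
  shows "is_eigenvalue q lam \<longleftrightarrow> (\<exists>u u'. sturm q (\<lambda>x. lam * u x) u u' \<and>
     (\<exists>x. u x \<noteq> 0) \<and> integrable lborel (\<lambda>x. (u x)\<^sup>2))"
proof
  assume "is_eigenvalue q lam"
  then obtain u u' where u: "sl_sol q (complex_of_real lam) u u'" "u \<noteq> (\<lambda>_. 0)" "square_integrable u"
    unfolding is_eigenvalue_def by blast
  have *: "\<exists>u u'. sturm q (\<lambda>x. lam * u x) u u' \<and> (\<exists>x. u x \<noteq> 0) \<and> integrable lborel (\<lambda>x. (u x)\<^sup>2)"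
    if h: "bounded_linear h" "\<And>r z. h (complex_of_real r * z) = r * h z" "\<And>z. \<bar>h z\<bar> \<le> cmod z" "h (u x) \<noteq> 0" for h x
  proof -
    note s = sturm_of_sl_sol[OF q u(1) h(1,2)]
    have c: "continuous_on UNIV (\<lambda>x. h (u x))" by (rule sturm_continuous(1)[OF s])
    have "integrable lborel (\<lambda>x. (h (u x))\<^sup>2)"
    proof (rule Bochner_Integration.integrable_bound)
      show "integrable lborel (\<lambda>x. (cmod (u x))\<^sup>2)" using u(3) by (simp add: square_integrable_def)
      have "continuous_on UNIV (\<lambda>x. (h (u x))\<^sup>2)" by (intro continuous_intros c)
      then show "(\<lambda>x. (h (u x))\<^sup>2) \<in> borel_measurable lborel"
        using borel_measurable_continuous_onI by auto
      show "AE x in lborel. norm ((h (u x))\<^sup>2) \<le> norm ((cmod (u x))\<^sup>2)"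
        using h(3) power_mono[OF h(3), of _ 2] by (intro AE_I2) simp
    qed
    with s h(4) show ?thesis
      by (intro exI[of _ "\<lambda>x. h (u x)"] exI[of _ "\<lambda>x. h (u' x)"]) auto
  qed
  obtain x where "u x \<noteq> 0" using u(2) by auto
  then have "Re (u x) \<noteq> 0 \<or> Im (u x) \<noteq> 0" by (simp add: complex_eq_iff)
  then show "\<exists>u u'. sturm q (\<lambda>x. lam * u x) u u' \<and> (\<exists>x. u x \<noteq> 0) \<and> integrable lborel (\<lambda>x. (u x)\<^sup>2)"
    using *[of Re x] *[of Im x] bounded_linear_Re bounded_linear_Im abs_Re_le_cmod abs_Im_le_cmod by auto
next
  assume "\<exists>u u'. sturm q (\<lambda>x. lam * u x) u u' \<and> (\<exists>x. u x \<noteq> 0) \<and> integrable lborel (\<lambda>x. (u x)\<^sup>2)"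
  then obtain u u' x where u: "sturm q (\<lambda>x. lam * u x) u u'" "u x \<noteq> 0" "integrable lborel (\<lambda>x. (u x)\<^sup>2)" by blast
  have "(\<lambda>x. complex_of_real (u x)) \<noteq> (\<lambda>_. 0)" using u(2) by (metis of_real_eq_0_iff)
  then show "is_eigenvalue q lam"
    unfolding is_eigenvalue_def square_integrable_def using sl_sol_of_sturm[OF u(1)] u(3)
    by (intro exI[of _ "\<lambda>x. complex_of_real (u x)"] exI[of _ "\<lambda>x. complex_of_real (u' x)"]) simp
qed

lemma locally_integrable_add_continuous:
  assumes "locally_integrable q" "continuous_on UNIV g"
  shows "locally_integrable (\<lambda>x. q x + g x)"
  unfolding locally_integrable_def
proof (intro allI set_integral_add(1))
  fix a b
  show "set_integrable lborel {a..b} q" using assms(1) by (simp add: locally_integrable_def)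
  show "set_integrable lborel {a..b} g" by (rule set_integrable_lborel_continuous[OF assms(2)])
qed

theorem theorem4p1:
  fixes q :: "real \<Rightarrow> real"
    and w :: "'n::finite \<Rightarrow> real"
    and phi phi' :: "'n \<Rightarrow> real \<Rightarrow> real"
  assumes "locally_integrable q"
    and "semibounded_below q"
    and "AE k in lborel. jost_exists q k"
    and "\<forall>n. w n > 0"
    and "\<forall>n. (w n)\<^sup>2 \<in> embedded_eigenvalues q"
    and "\<forall>n. simple_eigenvalue q ((w n)\<^sup>2)"
    and "\<forall>n. reflection_continuous_at q (w n)"
    and "\<forall>n. jost_pole_continuous_at q (w n)"
    and "\<forall>n. sl_sol q (complex_of_real ((w n)\<^sup>2))
                 (\<lambda>x. complex_of_real (phi n x)) (\<lambda>x. complex_of_real (phi' n x))"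
    and "\<forall>n. integrable lborel (\<lambda>x. (phi n x)\<^sup>2)"
    and "\<forall>n m. (LINT x|lborel. phi n x * phi m x) = (if n = m then 1 else 0)"
  shows "embedded_eigenvalues
           (\<lambda>x. q x - 2 * deriv (deriv (\<lambda>y. ln (det (mat 1 - Gminus phi y)))) x)
         = embedded_eigenvalues q - {(w n)\<^sup>2 | n. True}"
proof -
  interpret orthonormal_eigenfunctions q "\<lambda>n. (w n)\<^sup>2" phi phi'
  proof
    fix n
    show "sturm q (\<lambda>x. (w n)\<^sup>2 * phi n x) (phi n) (phi' n)"
      using sturm_of_sl_sol[OF assms(1) assms(9)[rule_format, of n] bounded_linear_Re] by simp
  qed (use assms in auto)
  \<comment> \<open>The correction \<open>2 * kap'\<close> is continuous, so the new potential stays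
    locally integrable and its complex eigenfunctions, too, can be replaced by real ones.\<close>
  have lq': "locally_integrable (\<lambda>x. q x + 2 * kap' x)"
    by (intro locally_integrable_add_continuous assms(1) continuous_intros continuous_kap)
  have "is_eigenvalue (\<lambda>x. q x + 2 * kap' x) lam \<longleftrightarrow> is_eigenvalue q lam \<and> (\<forall>n. lam \<noteq> (w n)\<^sup>2)" for lam
  proof
    assume "is_eigenvalue (\<lambda>x. q x + 2 * kap' x) lam"
    then obtain v v' x where "sturm (\<lambda>x. q x + 2 * kap' x) (\<lambda>x. lam * v x) v v'"
        "integrable lborel (\<lambda>x. (v x)\<^sup>2)" "v x \<noteq> 0"
      unfolding is_eigenvalue_iff_sturm[OF lq'] by blast
    from eigenvalue_backward[OF this] show "is_eigenvalue q lam \<and> (\<forall>n. lam \<noteq> (w n)\<^sup>2)"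
      unfolding is_eigenvalue_iff_sturm[OF assms(1)] by blast
  next
    assume e: "is_eigenvalue q lam \<and> (\<forall>n. lam \<noteq> (w n)\<^sup>2)"
    then obtain u u' x where "sturm q (\<lambda>x. lam * u x) u u'"
        "integrable lborel (\<lambda>x. (u x)\<^sup>2)" "u x \<noteq> 0"
      unfolding is_eigenvalue_iff_sturm[OF assms(1)] by blast
    from eigenvalue_forward[OF this] e show "is_eigenvalue (\<lambda>x. q x + 2 * kap' x) lam"
      unfolding is_eigenvalue_iff_sturm[OF lq'] by blast
  qed
  then show ?thesis
    unfolding embedded_eigenvalues_def potential_eq by auto
qed

end
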